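(* Let $N$ be an $A$-definable normal subgroup of $G$, let $\mu\in H^1_{\mathrm{def}}(\mathcal G,G)$, and let $N_\mu$ be the $A$-form of $N$ associated to $\mu$. Then there is a natural isomorphism of pointed sets between the twisted cohomology $H^1_{\mathrm{def}}(\mathcal G_\mu,N)$ and the non-twisted cohomology $H^1_{\mathrm{def}}(\mathcal G,N_\mu)$.
   Context: Setting. Fix a first-order structure $M$ and a subset $A$ of $M$ such that: (i) $M$ is atomic over $A$, i.e. for every finite tuple $a$ from $M$ the type $\mathrm{tp}(a/A)$ is isolated; (ii) for all finite tuples $a,b$ from $M$ with $\mathrm{tp}(a/A)=\mathrm{tp}(b/A)$ there is $\sigma\in\mathrm{Aut}(M/A)$ with $\sigma(a)=b$; (iii) the theory of $M$ eliminates imaginaries. Put $\mathcal G=\mathrm{Aut}(M/A)$. $G$ is an arbitrary group definable in $M$ with parameters from $A$; $\mathcal G$ acts on $G$ by group automorphisms. "Definable" means definable in $M$ with parameters from $M$; "$A$-definable" means definable with parameters from $A$. Tuples are finite. Definable cohomology. For an $A$-definable group $G$, a definable cocycle from $\mathcal G$ to $G$ is a map $\Phi:\mathcal G\to G$ with $\Phi(\sigma_1\sigma_2)=\Phi(\sigma_1)\cdot\sigma_1(\Phi(\sigma_2))$ for which there are a tuple $a$ from $M$ and an $A$-definable (partial) function $h(x,y)$ with $\Phi(\sigma)=h(a,\sigma(a))$ for all $\sigma\in\mathcal G$. The set of these is $Z^1_{\mathrm{def}}(\mathcal G,G)$. $\Phi$ and $\Psi$ are cohomologous if there is $b\in G$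 with $\Psi(\sigma)=b^{-1}\Phi(\sigma)\sigma(b)$ for all $\sigma$. $H^1_{\mathrm{def}}(\mathcal G,G)$ is the set of equivalence classes, pointed by the class of the trivial cocycle. (The same definitions apply to $N_\mu$.) Twisting. Let $\Phi\in Z^1_{\mathrm{def}}(\mathcal G,G)$ have cohomology class $\mu$. The twisted action of $\mathcal G$ on $N$ is $\sigma*n=\Phi(\sigma)\,\sigma(n)\,\Phi(\sigma)^{-1}$; write $\mathcal G_\Phi$ for $\mathcal G$ with this action. $Z^1_{\mathrm{def}}(\mathcal G_\Phi,N)$ is the set of maps $\Psi:\mathcal G\to N$ with $\Psi(\sigma_1\sigma_2)=\Psi(\sigma_1)\cdot(\sigma_1*\Psi(\sigma_2))$ that are definable (i.e. $\Psi(\sigma)=h(a,\sigma(a))$ for all $\sigma\in\mathcal G$, for some tuple $a$ and $A$-definable function $h$). $\Psi,\Lambda$ are cohomologous if there is $b\in N$ with $\Psi(\sigma)=b^{-1}\Lambda(\sigma)(\sigma*b)$ for all $\sigma$. $H^1_{\mathrm{def}}(\mathcal G_\Phi,N)$ is the set of classes, pointed by the class of the trivial cocycle. Up to natural isomorphism it depends only on $\mu$ and is denoted $H^1_{\mathrm{def}}(\mathcal G_\mu,N)$ (computed with any $\Phi$ of class $\mu$). The $A$-form $N_\mu$. $\mathrm{Aut}_{\mathrm{def}}(N)$ is the group of $M$-definable group automorphisms of $N$, on which $\sigma\in\mathcal G$ acts by applying $\sigma$ to graphs (similarly $\sigma(g)$ is defined for any definable map $g$). A definable cocycle from $\mathcal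 G$ to $\mathrm{Aut}_{\mathrm{def}}(N)$ is a map $\Lambda$ with $\Lambda(\sigma_1\sigma_2)=\Lambda(\sigma_1)\cdot\sigma_1(\Lambda(\sigma_2))$ and $\Lambda(\sigma)(-)=h(a,\sigma(a),-)$ for some tuple $a$ and $A$-definable $h$. $\Lambda,\Lambda'$ are cohomologous if $\Lambda'(\sigma)=\phi^{-1}\Lambda(\sigma)\sigma(\phi)$ for some $\phi\in\mathrm{Aut}_{\mathrm{def}}(N)$ and all $\sigma$. $H^1_{\mathrm{def}}(\mathcal G,\mathrm{Aut}_{\mathrm{def}}(N))$ is the set of classes. An $A$-form of $N$ is an $A$-definable group $H$ admitting an $M$-definable group isomorphism $g:N\to H$. The map $H\mapsto[\sigma\mapsto g^{-1}\circ\sigma(g)]$ is a bijection between $A$-forms of $N$ up to $A$-definable isomorphism and $H^1_{\mathrm{def}}(\mathcal G,\mathrm{Aut}_{\mathrm{def}}(N))$. With $\Phi$ of class $\mu$, the map $\Lambda_\Phi(\sigma)(n)=\Phi(\sigma)\,n\,\Phi(\sigma)^{-1}$ is a definable cocycle from $\mathcal G$ to $\mathrm{Aut}_{\mathrm{def}}(N)$ whose class depends only on $\mu$. $N_\mu$ is the $A$-form of $N$ (unique up to $A$-definable isomorphism) corresponding to this class. "Natural" refers to the map $H^1_{\mathrm{def}}(\mathcal G,N_\mu)\to H^1_{\mathrm{def}}(\mathcal G_\Phi,N)$, $[\Psi]\mapsto[f\circ\Psi]$, where $f:N_\mu\to N$ is a definable group isomorphism with $f\circ\sigma(f^{-1})=\Lambda_\Phi(\sigma)$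 for all $\sigma\in\mathcal G$. *)

theory Defs
  imports "HOL-Algebra.Coset" "HOL-Algebra.Bij"
begin

section \<open>First-order structures\<close>

datatype 'f fo_term = Var nat | Fun 'f "'f fo_term list"

datatype ('f, 'r) fo_formula =
    Eq "'f fo_term" "'f fo_term"
  | Rel 'r "'f fo_term list"
  | Neg "('f, 'r) fo_formula"
  | Conj "('f, 'r) fo_formula" "('f, 'r) fo_formula"
  | Ex "('f, 'r) fo_formula"

text \<open>The universe of a structure is the whole type \<open>'a\<close>. A symbol of the language is a name
  together with its arity, so that \<open>funs\<close> and \<open>rels\<close> may well be empty; the interpretation of a
  name on lists of another length is irrelevant.\<close>

record ('f, 'r, 'a) fo_structure =
  funs :: "('f \<times> nat) set"
  rels :: "('r \<times> nat) set"
  fun_interp :: "'f \<Rightarrow> 'a list \<Rightarrow> 'a"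
  rel_interp :: "'r \<Rightarrow> 'a list \<Rightarrow> bool"

text \<open>Variables are de Bruijn indices: the free variables of a formula evaluated at the list \<open>e\<close>
  are \<open>0, \<dots>, length e - 1\<close>, and \<open>Ex\<close> binds index \<open>0\<close>, shifting the others. \<open>wf_formula M k \<phi>\<close>
  says that \<open>\<phi>\<close> is a formula of the language of \<open>M\<close> with all free variables below \<open>k\<close>.\<close>

fun wf_term :: "('f, 'r, 'a) fo_structure \<Rightarrow> nat \<Rightarrow> 'f fo_term \<Rightarrow> bool" where
  "wf_term M k (Var i) \<longleftrightarrow> i < k"
| "wf_term M k (Fun f ts) \<longleftrightarrow> (f, length ts) \<in> funs M \<and> (\<forall>t\<in>set ts. wf_term M k t)"

fun wf_formula :: "('f, 'r, 'a) fo_structure \<Rightarrow> nat \<Rightarrow> ('f, 'r) fo_formula \<Rightarrow> bool" where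
  "wf_formula M k (Eq s t) \<longleftrightarrow> wf_term M k s \<and> wf_term M k t"
| "wf_formula M k (Rel r ts) \<longleftrightarrow> (r, length ts) \<in> rels M \<and> (\<forall>t\<in>set ts. wf_term M k t)"
| "wf_formula M k (Neg \<phi>) \<longleftrightarrow> wf_formula M k \<phi>"
| "wf_formula M k (Conj \<phi> \<psi>) \<longleftrightarrow> wf_formula M k \<phi> \<and> wf_formula M k \<psi>"
| "wf_formula M k (Ex \<phi>) \<longleftrightarrow> wf_formula M (Suc k) \<phi>"

fun eval_term :: "('f, 'r, 'a) fo_structure \<Rightarrow> 'a list \<Rightarrow> 'f fo_term \<Rightarrow> 'a" where
  "eval_term M e (Var i) = e ! i"
| "eval_term M e (Fun f ts) = fun_interp M f (map (eval_term M e) ts)"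

fun sat :: "('f, 'r, 'a) fo_structure \<Rightarrow> 'a list \<Rightarrow> ('f, 'r) fo_formula \<Rightarrow> bool" where
  "sat M e (Eq s t) \<longleftrightarrow> eval_term M e s = eval_term M e t"
| "sat M e (Rel r ts) \<longleftrightarrow> rel_interp M r (map (eval_term M e) ts)"
| "sat M e (Neg \<phi>) \<longleftrightarrow> \<not> sat M e \<phi>"
| "sat M e (Conj \<phi> \<psi>) \<longleftrightarrow> sat M e \<phi> \<and> sat M e \<psi>"
| "sat M e (Ex \<phi>) \<longleftrightarrow> (\<exists>x. sat M (x # e) \<phi>)"

definition aut_over :: "('f, 'r, 'a) fo_structure \<Rightarrow> 'a set \<Rightarrow> ('a \<Rightarrow> 'a) set" where
  "aut_over M A = {\<sigma>. bij \<sigma>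
     \<and> (\<forall>(f, n)\<in>funs M. \<forall>xs. length xs = n \<longrightarrow> \<sigma> (fun_interp M f xs) = fun_interp M f (map \<sigma> xs))
     \<and> (\<forall>(r, n)\<in>rels M. \<forall>xs. length xs = n \<longrightarrow> (rel_interp M r (map \<sigma> xs) \<longleftrightarrow> rel_interp M r xs))
     \<and> (\<forall>a\<in>A. \<sigma> a = a)}"

section \<open>Types, atomicity, homogeneity\<close>

text \<open>A formula over \<open>A\<close> is a pair of a formula and the list of its parameters, the latter being
  substituted for the last free variables.\<close>

definition tp :: "('f, 'r, 'a) fo_structure \<Rightarrow> 'a set \<Rightarrow> 'a list \<Rightarrow> (('f, 'r) fo_formula \<times> 'a list) set" where
  "tp M A a = {(\<phi>, ps). set ps \<subseteq> A \<and> wf_formula M (length a + length ps) \<phi> \<and> sat M (a @ ps) \<phi>}"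

definition isolated_tp :: "('f, 'r, 'a) fo_structure \<Rightarrow> 'a set \<Rightarrow> 'a list \<Rightarrow> bool" where
  "isolated_tp M A a \<longleftrightarrow>
     (\<exists>(\<theta>, ps)\<in>tp M A a. \<forall>(\<phi>, qs)\<in>tp M A a.
        \<forall>x. length x = length a \<longrightarrow> sat M (x @ ps) \<theta> \<longrightarrow> sat M (x @ qs) \<phi>)"

definition atomic_over :: "('f, 'r, 'a) fo_structure \<Rightarrow> 'a set \<Rightarrow> bool" where
  "atomic_over M A \<longleftrightarrow> (\<forall>a. isolated_tp M A a)"

definition homogeneous_over :: "('f, 'r, 'a) fo_structure \<Rightarrow> 'a set \<Rightarrow> bool" where
  "homogeneous_over M A \<longleftrightarrow>
     (\<forall>a b. length a = length b \<longrightarrow> tp M A a = tp M A b \<longrightarrow> (\<exists>\<sigma>\<in>aut_over M A. map \<sigma> a = b))"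

section \<open>Definable sets, maps and groups\<close>

definition definable_set :: "('f, 'r, 'a) fo_structure \<Rightarrow> 'a set \<Rightarrow> nat \<Rightarrow> 'a list set \<Rightarrow> bool" where
  "definable_set M B n X \<longleftrightarrow>
     (\<exists>\<phi> ps. set ps \<subseteq> B \<and> wf_formula M (n + length ps) \<phi>
        \<and> X = {x. length x = n \<and> sat M (x @ ps) \<phi>})"

text \<open>Partial functions from \<open>n\<close>-tuples to \<open>m\<close>-tuples. A function of several tuples is applied to
  their concatenation.\<close>

definition definable_pfun ::
    "('f, 'r, 'a) fo_structure \<Rightarrow> 'a set \<Rightarrow> nat \<Rightarrow> nat \<Rightarrow> ('a list \<rightharpoonup> 'a list) \<Rightarrow> bool" where
  "definable_pfun M B n m h \<longleftrightarrow>
     (\<forall>x y. h x = Some y \<longrightarrow> length x = n \<and> length y = m)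
     \<and> definable_set M B (n + m) {x @ y | x y. h x = Some y}"

definition definable_map ::
    "('f, 'r, 'a) fo_structure \<Rightarrow> 'a set \<Rightarrow> 'a list set \<Rightarrow> ('a list \<Rightarrow> 'a list) \<Rightarrow> bool" where
  "definable_map M B D g \<longleftrightarrow> (\<exists>n m. definable_pfun M B n m (\<lambda>x. if x \<in> D then Some (g x) else None))"

definition definable_group :: "('f, 'r, 'a) fo_structure \<Rightarrow> 'a set \<Rightarrow> 'a list monoid \<Rightarrow> bool" where
  "definable_group M B G \<longleftrightarrow> group G
     \<and> (\<exists>n. definable_set M B n (carrier G)
          \<and> definable_set M B (3 * n)
              {x @ y @ (x \<otimes>\<^bsub>G\<^esub> y) | x y. x \<in> carrier G \<and> y \<in> carrier G})"

text \<open>Uniform elimination of imaginaries. For each pair of defining formulas the condition is a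
  first-order sentence, so it depends only on the complete theory of \<open>M\<close>.\<close>

definition eliminates_imaginaries :: "('f, 'r, 'a) fo_structure \<Rightarrow> bool" where
  "eliminates_imaginaries M \<longleftrightarrow>
     (\<forall>n E. equiv {x. length x = n} E \<longrightarrow> definable_set M {} (n + n) {x @ y | x y. (x, y) \<in> E} \<longrightarrow>
        (\<exists>m f. definable_pfun M {} n m f \<and> dom f = {x. length x = n}
           \<and> (\<forall>x y. length x = n \<longrightarrow> length y = n \<longrightarrow> ((x, y) \<in> E \<longleftrightarrow> f x = f y))))"

section \<open>Cohomology\<close>

text \<open>Here \<open>S\<close> is a group of permutations under composition, acting on the group \<open>K\<close> by \<open>act\<close>, and
  \<open>Z\<close> is a set of cocycles.\<close>

definition cocycles ::
    "('a \<Rightarrow> 'a) set \<Rightarrow> (('a \<Rightarrow> 'a) \<Rightarrow> 'g \<Rightarrow> 'g) \<Rightarrow> 'g monoid \<Rightarrow> (('a \<Rightarrow> 'a) \<Rightarrow> 'g) set" where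
  "cocycles S act K =
     {\<Phi> \<in> S \<rightarrow>\<^sub>E carrier K. \<forall>\<sigma>\<in>S. \<forall>\<tau>\<in>S. \<Phi> (\<sigma> \<circ> \<tau>) = \<Phi> \<sigma> \<otimes>\<^bsub>K\<^esub> act \<sigma> (\<Phi> \<tau>)}"

definition cohomologous ::
    "('a \<Rightarrow> 'a) set \<Rightarrow> (('a \<Rightarrow> 'a) \<Rightarrow> 'g \<Rightarrow> 'g) \<Rightarrow> 'g monoid \<Rightarrow> (('a \<Rightarrow> 'a) \<Rightarrow> 'g) set
       \<Rightarrow> (('a \<Rightarrow> 'a) \<Rightarrow> 'g) rel" where
  "cohomologous S act K Z =
     {(\<Phi>, \<Psi>). \<Phi> \<in> Z \<and> \<Psi> \<in> Z \<and>
        (\<exists>b\<in>carrier K. \<forall>\<sigma>\<in>S. \<Psi> \<sigma> = inv\<^bsub>K\<^esub> b \<otimes>\<^bsub>K\<^esub> \<Phi> \<sigma> \<otimes>\<^bsub>K\<^esub> act \<sigma> b)}"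

definition definable_cochain ::
    "('f, 'r, 'a) fo_structure \<Rightarrow> 'a set \<Rightarrow> (('a \<Rightarrow> 'a) \<Rightarrow> 'a list) \<Rightarrow> bool" where
  "definable_cochain M A \<Phi> \<longleftrightarrow>
     (\<exists>a m h. definable_pfun M A (length a + length a) m h
        \<and> (\<forall>\<sigma>\<in>aut_over M A. h (a @ map \<sigma> a) = Some (\<Phi> \<sigma>)))"

definition Z1_def ::
    "('f, 'r, 'a) fo_structure \<Rightarrow> 'a set \<Rightarrow> (('a \<Rightarrow> 'a) \<Rightarrow> 'a list \<Rightarrow> 'a list) \<Rightarrow> 'a list monoid
       \<Rightarrow> (('a \<Rightarrow> 'a) \<Rightarrow> 'a list) set" where
  "Z1_def M A act K = {\<Phi> \<in> cocycles (aut_over M A) act K. definable_cochain M A \<Phi>}"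

text \<open>The untwisted action of \<open>\<sigma>\<close> on tuples is \<open>map \<sigma>\<close>, so the untwisted cohomology
  is obtained with \<open>act = map\<close>.\<close>

definition H1_class ::
    "('f, 'r, 'a) fo_structure \<Rightarrow> 'a set \<Rightarrow> (('a \<Rightarrow> 'a) \<Rightarrow> 'a list \<Rightarrow> 'a list) \<Rightarrow> 'a list monoid
       \<Rightarrow> (('a \<Rightarrow> 'a) \<Rightarrow> 'a list) \<Rightarrow> (('a \<Rightarrow> 'a) \<Rightarrow> 'a list) set" where
  "H1_class M A act K \<Phi> = cohomologous (aut_over M A) act K (Z1_def M A act K) `` {\<Phi>}"

definition H1_def ::
    "('f, 'r, 'a) fo_structure \<Rightarrow> 'a set \<Rightarrow> (('a \<Rightarrow> 'a) \<Rightarrow> 'a list \<Rightarrow> 'a list) \<Rightarrow> 'a list monoid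
       \<Rightarrow> (('a \<Rightarrow> 'a) \<Rightarrow> 'a list) set set" where
  "H1_def M A act K = Z1_def M A act K // cohomologous (aut_over M A) act K (Z1_def M A act K)"

definition H1_base ::
    "('f, 'r, 'a) fo_structure \<Rightarrow> 'a set \<Rightarrow> (('a \<Rightarrow> 'a) \<Rightarrow> 'a list \<Rightarrow> 'a list) \<Rightarrow> 'a list monoid
       \<Rightarrow> (('a \<Rightarrow> 'a) \<Rightarrow> 'a list) set" where
  "H1_base M A act K = H1_class M A act K (\<lambda>\<sigma>\<in>aut_over M A. \<one>\<^bsub>K\<^esub>)"

definition twisted_act ::
    "'a list monoid \<Rightarrow> (('a \<Rightarrow> 'a) \<Rightarrow> 'a list) \<Rightarrow> ('a \<Rightarrow> 'a) \<Rightarrow> 'a list \<Rightarrow> 'a list" where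
  "twisted_act G \<Phi> \<sigma> n = \<Phi> \<sigma> \<otimes>\<^bsub>G\<^esub> map \<sigma> n \<otimes>\<^bsub>G\<^esub> inv\<^bsub>G\<^esub> (\<Phi> \<sigma>)"

section \<open>Definable automorphisms and forms\<close>

definition Aut_def :: "('f, 'r, 'a) fo_structure \<Rightarrow> 'a list monoid \<Rightarrow> ('a list \<Rightarrow> 'a list) monoid" where
  "Aut_def M N = (AutoGroup N)\<lparr>carrier := {\<phi> \<in> auto N. definable_map M UNIV (carrier N) \<phi>}\<rparr>"

text \<open>The map whose graph is the image under \<open>\<sigma>\<close> of the graph of \<open>g\<close> on \<open>D\<close>.\<close>

definition act_map :: "'a list set \<Rightarrow> ('a \<Rightarrow> 'a) \<Rightarrow> ('a list \<Rightarrow> 'a list) \<Rightarrow> 'a list \<Rightarrow> 'a list" where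
  "act_map D \<sigma> g = (\<lambda>x\<in>map \<sigma> ` D. map \<sigma> (g (map (inv_into UNIV \<sigma>) x)))"

definition Z1_Aut ::
    "('f, 'r, 'a) fo_structure \<Rightarrow> 'a set \<Rightarrow> 'a list monoid \<Rightarrow> (('a \<Rightarrow> 'a) \<Rightarrow> 'a list \<Rightarrow> 'a list) set" where
  "Z1_Aut M A N =
     {\<Lambda> \<in> cocycles (aut_over M A) (act_map (carrier N)) (Aut_def M N).
        \<exists>a n m h. definable_pfun M A (length a + length a + n) m h
          \<and> (\<forall>\<sigma>\<in>aut_over M A. \<forall>x\<in>carrier N. h (a @ map \<sigma> a @ x) = Some (\<Lambda> \<sigma> x))}"

definition H1_Aut_class ::
    "('f, 'r, 'a) fo_structure \<Rightarrow> 'a set \<Rightarrow> 'a list monoid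
       \<Rightarrow> (('a \<Rightarrow> 'a) \<Rightarrow> 'a list \<Rightarrow> 'a list) \<Rightarrow> (('a \<Rightarrow> 'a) \<Rightarrow> 'a list \<Rightarrow> 'a list) set" where
  "H1_Aut_class M A N \<Lambda> =
     cohomologous (aut_over M A) (act_map (carrier N)) (Aut_def M N) (Z1_Aut M A N) `` {\<Lambda>}"

definition H1_Aut ::
    "('f, 'r, 'a) fo_structure \<Rightarrow> 'a set \<Rightarrow> 'a list monoid
       \<Rightarrow> (('a \<Rightarrow> 'a) \<Rightarrow> 'a list \<Rightarrow> 'a list) set set" where
  "H1_Aut M A N =
     Z1_Aut M A N // cohomologous (aut_over M A) (act_map (carrier N)) (Aut_def M N) (Z1_Aut M A N)"

definition definable_iso ::
    "('f, 'r, 'a) fo_structure \<Rightarrow> 'a list monoid \<Rightarrow> 'a list monoid \<Rightarrow> ('a list \<Rightarrow> 'a list) set" where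
  "definable_iso M H K = {g \<in> iso H K. definable_map M UNIV (carrier H) g}"

definition A_form :: "('f, 'r, 'a) fo_structure \<Rightarrow> 'a set \<Rightarrow> 'a list monoid \<Rightarrow> 'a list monoid \<Rightarrow> bool" where
  "A_form M A N H \<longleftrightarrow> definable_group M A H \<and> definable_iso M N H \<noteq> {}"

text \<open>\<open>\<sigma> \<mapsto> g\<^sup>-\<^sup>1 \<circ> \<sigma>(g)\<close>\<close>

definition form_cocycle ::
    "('f, 'r, 'a) fo_structure \<Rightarrow> 'a set \<Rightarrow> 'a list monoid \<Rightarrow> ('a list \<Rightarrow> 'a list)
       \<Rightarrow> ('a \<Rightarrow> 'a) \<Rightarrow> 'a list \<Rightarrow> 'a list" where
  "form_cocycle M A N g =
     (\<lambda>\<sigma>\<in>aut_over M A. compose (carrier N) (inv_into (carrier N) g) (act_map (carrier N) \<sigma> g))"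

definition form_corresponds ::
    "('f, 'r, 'a) fo_structure \<Rightarrow> 'a set \<Rightarrow> 'a list monoid \<Rightarrow> 'a list monoid
       \<Rightarrow> (('a \<Rightarrow> 'a) \<Rightarrow> 'a list \<Rightarrow> 'a list) set \<Rightarrow> bool" where
  "form_corresponds M A N H \<xi> \<longleftrightarrow>
     A_form M A N H \<and> \<xi> \<in> H1_Aut M A N
     \<and> (\<exists>g\<in>definable_iso M N H. H1_Aut_class M A N (form_cocycle M A N g) = \<xi>)"

text \<open>The cocycle \<open>\<Lambda>\<^sub>\<Phi>\<close>; here \<open>N\<close> is a subset of \<open>G\<close>.\<close>

definition conj_cocycle ::
    "('f, 'r, 'a) fo_structure \<Rightarrow> 'a set \<Rightarrow> 'a list monoid \<Rightarrow> 'a list set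
       \<Rightarrow> (('a \<Rightarrow> 'a) \<Rightarrow> 'a list) \<Rightarrow> ('a \<Rightarrow> 'a) \<Rightarrow> 'a list \<Rightarrow> 'a list" where
  "conj_cocycle M A G N \<Phi> =
     (\<lambda>\<sigma>\<in>aut_over M A. \<lambda>n\<in>N. \<Phi> \<sigma> \<otimes>\<^bsub>G\<^esub> n \<otimes>\<^bsub>G\<^esub> inv\<^bsub>G\<^esub> (\<Phi> \<sigma>))"

text \<open>\<open>H\<close> is (a copy of) \<open>N\<^sub>\<mu>\<close>, which is determined up to \<open>A\<close>-definable isomorphism only.\<close>

definition associated_form ::
    "('f, 'r, 'a) fo_structure \<Rightarrow> 'a set \<Rightarrow> 'a list monoid \<Rightarrow> 'a list set
       \<Rightarrow> (('a \<Rightarrow> 'a) \<Rightarrow> 'a list) set \<Rightarrow> 'a list monoid \<Rightarrow> bool" where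
  "associated_form M A G N \<mu> H \<longleftrightarrow>
     (\<exists>\<Phi>\<in>\<mu>. form_corresponds M A (G\<lparr>carrier := N\<rparr>) H
              (H1_Aut_class M A (G\<lparr>carrier := N\<rparr>) (conj_cocycle M A G N \<Phi>)))"

text \<open>The definable isomorphisms \<open>f : H \<rightarrow> N\<close> with \<open>f \<circ> \<sigma>(f\<^sup>-\<^sup>1) = \<Lambda>\<^sub>\<Phi>(\<sigma>)\<close> for all \<open>\<sigma>\<close>.\<close>

definition twisting_isos ::
    "('f, 'r, 'a) fo_structure \<Rightarrow> 'a set \<Rightarrow> 'a list monoid \<Rightarrow> 'a list set
       \<Rightarrow> (('a \<Rightarrow> 'a) \<Rightarrow> 'a list) \<Rightarrow> 'a list monoid \<Rightarrow> ('a list \<Rightarrow> 'a list) set" where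
  "twisting_isos M A G N \<Phi> H =
     {f \<in> definable_iso M H (G\<lparr>carrier := N\<rparr>).
        \<forall>\<sigma>\<in>aut_over M A.
          compose N f (act_map N \<sigma> (inv_into (carrier H) f)) = conj_cocycle M A G N \<Phi> \<sigma>}"

end

theory Submission
  imports Defs
begin

text \<open>A twisting isomorphism \<open>f : H \<rightarrow> N\<close> satisfies \<open>f \<circ> \<sigma>(f\<^sup>-\<^sup>1) = \<Lambda>\<^sub>\<Phi>(\<sigma>)\<close>, and reading this equation at
  the point \<open>\<sigma>(f h)\<close> it says \<open>f(\<sigma> h) = \<sigma> * f(h)\<close>: the form \<open>H\<close> is the group \<open>N\<close> with its twisted
  action, seen through \<open>f\<close> (\<open>twisting_isos_iff\<close>). Along an equivariant isomorphism of groups,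
  cocycles and coboundary relations correspond to one another, so the map on cohomology is simply
  \<open>[\<Psi>] \<mapsto> [f \<circ> \<Psi>]\<close>, realised here as the image of a class under \<open>\<Psi> \<mapsto> f \<circ> \<Psi>\<close>
  (locale \<open>equivariant_definable_iso\<close>). Two points need an argument.

  The first is definability. The map \<open>f\<close> is definable with arbitrary parameters \<open>c\<close>, whereas a
  definable cochain has to be of the form \<open>\<sigma> \<mapsto> h(a, \<sigma>(a))\<close> with \<open>h\<close> definable over \<open>A\<close>. The
  parameters are therefore moved into the tuple: if \<open>\<Psi>(\<sigma>) = h(a, \<sigma>(a))\<close> and \<open>f(x) = k(c, x)\<close>, then
  \<open>f(\<Psi>(\<sigma>))\<close> is an \<open>A\<close>-definable function of \<open>(c, a)\<close> and \<open>\<sigma>(c, a)\<close>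
  (\<open>definable_cochain_compose\<close>). The formula that defines \<open>f\<close> with the parameters \<open>c\<close> need not define
  a function for other parameters, so the relation obtained is cut down to the places where it has
  exactly one value, which is again a definable condition (\<open>definable_pfun_unique\<close>). Since \<open>f\<^sup>-\<^sup>1\<close> is
  definable too, \<open>\<Psi>\<close> is definable if and only if \<open>f \<circ> \<Psi>\<close> is.

  The second is the existence of \<open>f\<close> for the given representative \<open>\<Phi>\<close> of \<open>\<mu>\<close>
  (\<open>twisting_isos_nonempty\<close>). The form \<open>H\<close> comes with some \<open>g : N \<rightarrow> H\<close> whose cocycle
  \<open>g\<^sup>-\<^sup>1 \<circ> \<sigma>(g)\<close> has the same class as \<open>\<Lambda>\<^bsub>\<Phi>\<^sub>0\<^esub>\<close> for some \<open>\<Phi>\<^sub>0\<close> in \<open>\<mu>\<close>. If \<open>\<psi>\<close> and \<open>\<phi>\<close> are definable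
  automorphisms of \<open>N\<close> that carry these two cocycles to a common one, then \<open>\<phi> \<circ> (g \<circ> \<psi>)\<^sup>-\<^sup>1\<close> is
  equivariant for the action twisted by \<open>\<Phi>\<^sub>0\<close>; and if \<open>\<Phi>(\<sigma>) = b\<^sup>-\<^sup>1 \<Phi>\<^sub>0(\<sigma>) \<sigma>(b)\<close>, then composing with
  conjugation by \<open>b\<^sup>-\<^sup>1\<close> passes from the action twisted by \<open>\<Phi>\<^sub>0\<close> to the one twisted by \<open>\<Phi>\<close>.\<close>

section \<open>Definable sets\<close>

fun rename_term :: "(nat \<Rightarrow> nat) \<Rightarrow> 'f fo_term \<Rightarrow> 'f fo_term" where
  "rename_term r (Var i) = Var (r i)"
| "rename_term r (Fun f ts) = Fun f (map (rename_term r) ts)"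

text \<open>A renaming is extended under a quantifier by fixing the bound index \<open>0\<close> and shifting the rest.
  Renaming is enough to permute, duplicate, drop and specialise variables, because parameters occupy
  the last free variables.\<close>

fun rename_formula :: "(nat \<Rightarrow> nat) \<Rightarrow> ('f, 'r) fo_formula \<Rightarrow> ('f, 'r) fo_formula" where
  "rename_formula r (Eq s t) = Eq (rename_term r s) (rename_term r t)"
| "rename_formula r (Rel R ts) = Rel R (map (rename_term r) ts)"
| "rename_formula r (Neg \<phi>) = Neg (rename_formula r \<phi>)"
| "rename_formula r (Conj \<phi> \<psi>) = Conj (rename_formula r \<phi>) (rename_formula r \<psi>)"
| "rename_formula r (Ex \<phi>) = Ex (rename_formula (case_nat 0 (\<lambda>i. Suc (r i))) \<phi>)"

lemma wf_rename_term:
  "wf_term M k t \<Longrightarrow> (\<And>i. i < k \<Longrightarrow> r i < l) \<Longrightarrow> wf_term M l (rename_term r t)"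
  by (induction t) auto

lemma wf_rename_formula:
  "wf_formula M k \<phi> \<Longrightarrow> (\<And>i. i < k \<Longrightarrow> r i < l) \<Longrightarrow> wf_formula M l (rename_formula r \<phi>)"
proof (induction \<phi> arbitrary: k l r)
  case (Ex \<phi>)
  have "wf_formula M (Suc l) (rename_formula (case_nat 0 (\<lambda>i. Suc (r i))) \<phi>)"
    by (rule Ex.IH[of "Suc k"]) (use Ex.prems in \<open>auto split: nat.split\<close>)
  then show ?case by simp
qed (auto intro: wf_rename_term)

lemma eval_rename_term:
  assumes "wf_term M k t" and "\<And>i. i < k \<Longrightarrow> e' ! i = e ! r i"
  shows "eval_term M e (rename_term r t) = eval_term M e' t"
  using assms
proof (induction t)
  case (Fun f ts)
  then have "map (eval_term M e \<circ> rename_term r) ts = map (eval_term M e') ts" by auto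
  then show ?case by (simp del: map_eq_conv)
qed simp

lemma sat_rename_formula:
  assumes "wf_formula M k \<phi>" and "\<And>i. i < k \<Longrightarrow> e' ! i = e ! r i"
  shows "sat M e (rename_formula r \<phi>) \<longleftrightarrow> sat M e' \<phi>"
  using assms
proof (induction \<phi> arbitrary: k e e' r)
  case (Eq s t)
  then show ?case by (simp add: eval_rename_term[of M k _ e' e r])
next
  case (Rel R ts)
  then have "map (eval_term M e \<circ> rename_term r) ts = map (eval_term M e') ts"
    by (auto intro!: eval_rename_term[of M k])
  then show ?case by (simp del: map_eq_conv)
next
  case (Neg \<phi>)
  then show ?case by (metis rename_formula.simps(3) sat.simps(3) wf_formula.simps(3))
next
  case (Conj \<phi> \<psi>)
  have "sat M e (rename_formula r \<phi>) = sat M e' \<phi>"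
    by (rule Conj.IH(1)[of k]) (use Conj.prems in auto)
  moreover have "sat M e (rename_formula r \<psi>) = sat M e' \<psi>"
    by (rule Conj.IH(2)[of k]) (use Conj.prems in auto)
  ultimately show ?case by simp
next
  case (Ex \<phi>)
  have "sat M (x # e) (rename_formula (case_nat 0 (\<lambda>i. Suc (r i))) \<phi>) = sat M (x # e') \<phi>" for x
    by (rule Ex.IH[of "Suc k"]) (use Ex.prems in \<open>auto split: nat.split\<close>)
  then show ?case by simp
qed

lemma definable_set_length: "definable_set M B n X \<Longrightarrow> x \<in> X \<Longrightarrow> length x = n"
  unfolding definable_set_def by auto

lemma definable_set_mono: "definable_set M B n X \<Longrightarrow> B \<subseteq> C \<Longrightarrow> definable_set M C n X"
  unfolding definable_set_def by blast

lemma definable_set_cong: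
  assumes "definable_set M B n X" and "\<And>x. x \<in> X \<Longrightarrow> x \<in> Y" and "\<And>x. x \<in> Y \<Longrightarrow> x \<in> X"
  shows "definable_set M B n Y"
  using assms by (metis subsetI subset_antisym)

lemma definable_set_formula:
  "wf_formula M n \<phi> \<Longrightarrow> definable_set M B n {x. length x = n \<and> sat M x \<phi>}"
  unfolding definable_set_def by (intro exI[of _ \<phi>] exI[of _ "[]"]) simp

text \<open>Replacing the variables of a definable condition by other variables or by parameters. Here
  \<open>is\<close> lists positions in \<open>z @ cs\<close>, so that an entry beyond \<open>n\<close> stands for one of the parameters \<open>cs\<close>.\<close>

lemma definable_set_substitute:
  assumes X: "definable_set M B k X" and cs: "set cs \<subseteq> B"
    and is_length: "length is = k" and is_bound: "\<And>i. i \<in> set is \<Longrightarrow> i < n + length cs"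
  shows "definable_set M B n {z. length z = n \<and> map ((!) (z @ cs)) is \<in> X}"
proof -
  from X obtain \<phi> ps where ps: "set ps \<subseteq> B" and wf: "wf_formula M (k + length ps) \<phi>"
    and X_eq: "X = {x. length x = k \<and> sat M (x @ ps) \<phi>}"
    unfolding definable_set_def by blast
  define r where "r i = (if i < k then is ! i else n + length cs + (i - k))" for i
  have "wf_formula M (n + length (cs @ ps)) (rename_formula r \<phi>)"
    by (rule wf_rename_formula[OF wf])
      (use is_bound[OF nth_mem] is_length in \<open>auto simp: r_def add.assoc[symmetric] intro: trans_less_add1\<close>)
  moreover have "sat M (z @ cs @ ps) (rename_formula r \<phi>) \<longleftrightarrow> map ((!) (z @ cs)) is \<in> X"
    if "length z = n" for z
  proof -
    have "(map ((!) (z @ cs)) is @ ps) ! i = (z @ cs @ ps) ! r i" if "i < k + length ps" for i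
    proof (cases "i < k")
      case True
      then have "is ! i < length (z @ cs)" using is_bound is_length \<open>length z = n\<close> by simp
      then have "((z @ cs) @ ps) ! (is ! i) = (z @ cs) ! (is ! i)" by (simp only: nth_append) simp
      then show ?thesis using True is_length by (simp add: r_def nth_append)
    next
      case False
      then obtain j where "i = k + j" by (metis le_Suc_ex not_less)
      then show ?thesis using is_length \<open>length z = n\<close> by (simp add: r_def nth_append)
    qed
    from sat_rename_formula[OF wf this] show ?thesis using is_length by (simp add: X_eq)
  qed
  ultimately show ?thesis
    unfolding definable_set_def using cs ps
    by (intro exI[of _ "rename_formula r \<phi>"] exI[of _ "cs @ ps"]) auto
qed

text \<open>Reads off tuples of variables from a concatenation of tuples in another order, with some of
  them repeated or left out: a pair \<open>(i, l)\<close> stands for the tuple of length \<open>l\<close> at position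
  \<open>i\<close>.\<close>

abbreviation blocks :: "(nat \<times> nat) list \<Rightarrow> 'b list \<Rightarrow> 'b list" where
  "blocks bs w \<equiv> concat (map (\<lambda>(i, l). take l (drop i w)) bs)"

lemma map_nth_upt:
  "i + l \<le> length w \<Longrightarrow> map ((!) w) [i..<i + l] = take l (drop i w)"
  by (rule nth_equalityI) auto

lemma definable_set_blocks:
  assumes X: "definable_set M B k X" and cs: "set cs \<subseteq> B"
    and len: "sum_list (map snd bs) = k"
    and bound: "\<forall>(i, l)\<in>set bs. i + l \<le> n + length cs"
  shows "definable_set M B n
           {z. length z = n \<and> blocks bs (z @ cs) \<in> X}"
proof -
  let ?is = "concat (map (\<lambda>(i, l). [i..<i + l]) bs)"
  have blocks: "map ((!) w) ?is = blocks bs w"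
    if "length w = n + length cs" for w
    using bound that by (induction bs) (auto simp: map_nth_upt)
  have eq: "map ((!) (z @ cs)) ?is = blocks bs (z @ cs)"
    if "length z = n" for z by (rule blocks) (simp add: that)
  have "length ?is = k" unfolding len[symmetric] by (induction bs) auto
  moreover have "\<And>i. i \<in> set ?is \<Longrightarrow> i < n + length cs" using bound by fastforce
  ultimately have "definable_set M B n {z. length z = n \<and> map ((!) (z @ cs)) ?is \<in> X}"
    by (intro definable_set_substitute[OF X cs])
  then show ?thesis
    by (rule back_subst[of "definable_set M B n"]) (intro Collect_cong conj_cong refl, simp only: eq)
qed

lemma definable_set_Int:
  assumes "definable_set M B n X" and "definable_set M B n Y"
  shows "definable_set M B n (X \<inter> Y)"
proof -
  from assms(1) obtain \<phi> ps where
    ps: "set ps \<subseteq> B" "wf_formula M (n + length ps) \<phi>" "X = {x. length x = n \<and> sat M (x @ ps) \<phi>}"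
    unfolding definable_set_def by blast
  from assms(2) obtain \<psi> qs where
    qs: "set qs \<subseteq> B" "wf_formula M (n + length qs) \<psi>" "Y = {x. length x = n \<and> sat M (x @ qs) \<psi>}"
    unfolding definable_set_def by blast
  define r where "r i = (if i < n then i else i + length ps)" for i
  have "wf_formula M (n + length (ps @ qs)) (Conj (rename_formula id \<phi>) (rename_formula r \<psi>))"
    by (auto intro!: wf_rename_formula[OF ps(2)] wf_rename_formula[OF qs(2)] simp: r_def)
  moreover have "sat M (x @ ps @ qs) (rename_formula id \<phi>) \<longleftrightarrow> sat M (x @ ps) \<phi>"
    if "length x = n" for x
    by (rule sat_rename_formula[OF ps(2)]) (use that in \<open>auto simp: nth_append\<close>)
  moreover have "sat M (x @ ps @ qs) (rename_formula r \<psi>) \<longleftrightarrow> sat M (x @ qs) \<psi>"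
    if "length x = n" for x
    by (rule sat_rename_formula[OF qs(2)]) (use that in \<open>auto simp: nth_append r_def\<close>)
  ultimately show ?thesis
    unfolding definable_set_def using ps qs
    by (intro exI[of _ "Conj (rename_formula id \<phi>) (rename_formula r \<psi>)"] exI[of _ "ps @ qs"]) auto
qed

lemma definable_set_compl:
  assumes "definable_set M B n X"
  shows "definable_set M B n {x. length x = n \<and> x \<notin> X}"
proof -
  from assms obtain \<phi> ps where
    "set ps \<subseteq> B" "wf_formula M (n + length ps) \<phi>" "X = {x. length x = n \<and> sat M (x @ ps) \<phi>}"
    unfolding definable_set_def by blast
  then show ?thesis
    unfolding definable_set_def by (intro exI[of _ "Neg \<phi>"] exI[of _ ps]) auto
qed

text \<open>The projected coordinates come first, which is where \<open>Ex\<close> binds: one application of \<open>Ex\<close> removes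
  the leading coordinate.\<close>

lemma definable_set_proj:
  assumes "definable_set M B (m + n) X"
  shows "definable_set M B n {x. length x = n \<and> (\<exists>y. length y = m \<and> y @ x \<in> X)}"
  using assms
proof (induction m arbitrary: X)
  case 0
  then have "{x. length x = n \<and> (\<exists>y. length y = 0 \<and> y @ x \<in> X)} = X"
    using definable_set_length[OF 0] by auto
  then show ?case using 0 by simp
next
  case (Suc m)
  then obtain \<phi> ps where
    "set ps \<subseteq> B" "wf_formula M (Suc m + n + length ps) \<phi>"
    "X = {x. length x = Suc m + n \<and> sat M (x @ ps) \<phi>}"
    unfolding definable_set_def by blast
  then have "definable_set M B (m + n) {w. length w = m + n \<and> (\<exists>a. a # w \<in> X)}"
    unfolding definable_set_def by (intro exI[of _ "Ex \<phi>"] exI[of _ ps]) auto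
  from Suc.IH[OF this] show ?case
    by (rule back_subst[of "definable_set M B n"])
      (auto simp: length_Suc_conv, metis append_Cons, metis)
qed

lemma definable_set_eq_blocks:
  assumes "i + l \<le> n" and "j + l \<le> n"
  shows "definable_set M B n {z. length z = n \<and> take l (drop i z) = take l (drop j z)}"
  using assms
proof (induction l)
  case 0
  \<comment> \<open>a tautology that has no free variables, hence is well formed even for \<open>n = 0\<close>\<close>
  have "definable_set M B n {z. length z = n \<and> sat M z (Ex (Eq (Var 0) (Var 0)))}"
    by (rule definable_set_formula) simp
  then show ?case by simp
next
  case (Suc l)
  have "definable_set M B n {z. length z = n \<and> sat M z (Eq (Var (i + l)) (Var (j + l)))}"
    by (rule definable_set_formula) (use Suc.prems in simp)
  with Suc have "definable_set M B n
      ({z. length z = n \<and> take l (drop i z) = take l (drop j z)}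
       \<inter> {z. length z = n \<and> sat M z (Eq (Var (i + l)) (Var (j + l)))})"
    by (intro definable_set_Int) auto
  then show ?case
    by (rule back_subst[of "definable_set M B n"])
      (use Suc.prems in \<open>auto simp: take_Suc_conv_app_nth\<close>)
qed

section \<open>Definable maps\<close>

text \<open>The lengths of arguments and values are uniform, so the partial function in the definition of
  \<open>definable_map\<close> can be replaced by the graph of \<open>g\<close> on \<open>D\<close>.\<close>

lemma definable_map_iff:
  "definable_map M B D g \<longleftrightarrow>
     (\<exists>n m. (\<forall>x\<in>D. length x = n \<and> length (g x) = m) \<and> definable_set M B (n + m) {x @ g x | x. x \<in> D})"
proof -
  have "{x @ y | x y. (if x \<in> D then Some (g x) else None) = Some y} = {x @ g x | x. x \<in> D}"
    by (auto split: if_splits)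
  then show ?thesis
    unfolding definable_map_def definable_pfun_def by (simp split: if_splits) metis
qed

lemma definable_map_cong:
  assumes "definable_map M B D g" and "\<And>x. x \<in> D \<Longrightarrow> g x = g' x"
  shows "definable_map M B D g'"
proof -
  have "(\<lambda>x. if x \<in> D then Some (g x) else None) = (\<lambda>x. if x \<in> D then Some (g' x) else None)"
    using assms(2) by auto
  then show ?thesis using assms(1) unfolding definable_map_def by simp
qed

lemma definable_map_restrict_domain:
  assumes g: "definable_map M B D g" and E: "definable_set M B k E" and sub: "E \<subseteq> D"
  shows "definable_map M B E g"
proof -
  from g obtain n m where len: "\<And>x. x \<in> D \<Longrightarrow> length x = n \<and> length (g x) = m"
    and gr: "definable_set M B (n + m) {x @ g x | x. x \<in> D}"
    unfolding definable_map_iff by blast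
  show ?thesis
  proof (cases "E = {}")
    case True
    \<comment> \<open>the empty set is definable, as the intersection of the graph with its complement; its arity
      \<open>k\<close> need not be the length of the arguments of \<open>g\<close>\<close>
    have "definable_set M B (n + m)
        ({x @ g x | x. x \<in> D} \<inter> {z. length z = n + m \<and> z \<notin> {x @ g x | x. x \<in> D}})"
      by (intro definable_set_Int definable_set_compl gr)
    then have "definable_set M B (n + m) {x @ g x | x. x \<in> E}"
      by (rule back_subst[of "definable_set M B (n + m)"]) (use True in auto)
    then show ?thesis unfolding definable_map_iff using len sub by blast
  next
    case False
    then have k: "k = n" using definable_set_length[OF E] len sub by blast
    have "definable_set M B (n + m) {z. length z = n + m \<and> blocks [(0, n)] (z @ []) \<in> E}"
      by (rule definable_set_blocks[OF E]) (auto simp: k)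
    from definable_set_Int[OF gr this]
    have "definable_set M B (n + m) {x @ g x | x. x \<in> E}"
      by (rule back_subst[of "definable_set M B (n + m)"]) (use len sub in auto)
    then show ?thesis unfolding definable_map_iff using len sub by blast
  qed
qed

lemma definable_map_id:
  assumes D: "definable_set M B n D"
  shows "definable_map M B D (\<lambda>x. x)"
proof -
  have "definable_set M B (n + n) {z. length z = n + n \<and> blocks [(0, n)] (z @ []) \<in> D}"
    by (rule definable_set_blocks[OF D]) auto
  moreover have "definable_set M B (n + n)
      {z. length z = n + n \<and> take n (drop 0 z) = take n (drop n z)}"
    by (rule definable_set_eq_blocks) auto
  ultimately have "definable_set M B (n + n) ({z. length z = n + n \<and> blocks [(0, n)] (z @ []) \<in> D}
      \<inter> {z. length z = n + n \<and> take n (drop 0 z) = take n (drop n z)})"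
    by (rule definable_set_Int)
  then have "definable_set M B (n + n) {x @ x | x. x \<in> D}"
  proof (rule definable_set_cong)
    fix z assume "z \<in> {z. length z = n + n \<and> blocks [(0, n)] (z @ []) \<in> D}
      \<inter> {z. length z = n + n \<and> take n (drop 0 z) = take n (drop n z)}"
    then have "take n z \<in> D" "drop n z = take n z" by auto
    then show "z \<in> {x @ x | x. x \<in> D}" by (metis (mono_tags, lifting) append_take_drop_id mem_Collect_eq)
  qed (use definable_set_length[OF D] in auto)
  then show ?thesis
    unfolding definable_map_iff using definable_set_length[OF D] by blast
qed

text \<open>The graph of the composite is the projection, along the intermediate value \<open>y\<close>, of the
  conjunction of the two graphs, evaluated at tuples ordered as \<open>y\<close>, \<open>x\<close>, \<open>z\<close>.\<close>

lemma definable_map_comp: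
  assumes f: "definable_map M B E f" and g: "definable_map M B D g" and sub: "g ` D \<subseteq> E"
  shows "definable_map M B D (\<lambda>x. f (g x))"
proof (cases "D = {}")
  case True
  then show ?thesis by (intro definable_map_cong[OF g]) auto
next
  case False
  from g obtain n m where len: "\<And>x. x \<in> D \<Longrightarrow> length x = n \<and> length (g x) = m"
    and gr: "definable_set M B (n + m) {x @ g x | x. x \<in> D}"
    unfolding definable_map_iff by blast
  from f obtain m' p where len': "\<And>x. x \<in> E \<Longrightarrow> length x = m' \<and> length (f x) = p"
    and gr': "definable_set M B (m' + p) {x @ f x | x. x \<in> E}"
    unfolding definable_map_iff by blast
  have m': "m' = m" using False len len' sub by blast
  have "definable_set M B (m + (n + p)) {z. length z = m + (n + p) \<and>
      blocks [(m, n), (0, m)] (z @ []) \<in> {x @ g x | x. x \<in> D}}"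
    by (rule definable_set_blocks[OF gr]) auto
  moreover have "definable_set M B (m + (n + p)) {z. length z = m + (n + p) \<and>
      blocks [(0, m), (m + n, p)] (z @ []) \<in> {x @ f x | x. x \<in> E}}"
    by (rule definable_set_blocks[OF gr']) (auto simp: m')
  ultimately have "definable_set M B (n + p) {x. length x = n + p \<and> (\<exists>y. length y = m \<and> y @ x \<in>
     {z. length z = m + (n + p) \<and> blocks [(m, n), (0, m)] (z @ []) \<in> {x @ g x | x. x \<in> D}}
     \<inter> {z. length z = m + (n + p) \<and>
       blocks [(0, m), (m + n, p)] (z @ []) \<in> {x @ f x | x. x \<in> E}})}"
    by (intro definable_set_proj definable_set_Int)
  then have "definable_set M B (n + p) {x @ f (g x) | x. x \<in> D}"
  proof (rule definable_set_cong)
    fix v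
    assume "v \<in> {x. length x = n + p \<and> (\<exists>y. length y = m \<and> y @ x \<in>
     {z. length z = m + (n + p) \<and> blocks [(m, n), (0, m)] (z @ []) \<in> {x @ g x | x. x \<in> D}}
     \<inter> {z. length z = m + (n + p) \<and>
       blocks [(0, m), (m + n, p)] (z @ []) \<in> {x @ f x | x. x \<in> E}})}"
    then obtain y x w where v: "length v = n + p" "length y = m"
      and x: "take n v @ y = x @ g x" "x \<in> D"
      and w: "y @ take p (drop n v) = w @ f w" "w \<in> E"
      by auto
    have "take n v = x" "y = g x" using x v len[OF x(2)] by (auto simp: append_eq_append_conv)
    moreover have "y = w" "drop n v = f w" using w v len'[OF w(2)] m' by (auto simp: append_eq_append_conv)
    ultimately have "v = x @ f (g x)" by (metis append_take_drop_id)
    then show "v \<in> {x @ f (g x) | x. x \<in> D}" using x(2) by blast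
  next
    fix v assume "v \<in> {x @ f (g x) | x. x \<in> D}"
    then obtain x where x: "x \<in> D" and v: "v = x @ f (g x)" by blast
    have "g x \<in> E" using x sub by blast
    then show "v \<in> {x. length x = n + p \<and> (\<exists>y. length y = m \<and> y @ x \<in>
     {z. length z = m + (n + p) \<and> blocks [(m, n), (0, m)] (z @ []) \<in> {x @ g x | x. x \<in> D}}
     \<inter> {z. length z = m + (n + p) \<and>
       blocks [(0, m), (m + n, p)] (z @ []) \<in> {x @ f x | x. x \<in> E}})}"
      using len[OF x] len'[of "g x"] x v by (simp, intro exI[of _ "g x"]) auto
  qed
  moreover have "\<forall>x\<in>D. length x = n \<and> length (f (g x)) = p" using len len' sub by blast
  ultimately show ?thesis unfolding definable_map_iff by blast
qed

lemma definable_map_inv_into: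
  assumes g: "definable_map M B D g" and inj: "inj_on g D"
  shows "definable_map M B (g ` D) (inv_into D g)"
proof -
  from g obtain n m where len: "\<And>x. x \<in> D \<Longrightarrow> length x = n \<and> length (g x) = m"
    and gr: "definable_set M B (n + m) {x @ g x | x. x \<in> D}"
    unfolding definable_map_iff by blast
  have "definable_set M B (m + n) {z. length z = m + n \<and>
      blocks [(m, n), (0, m)] (z @ []) \<in> {x @ g x | x. x \<in> D}}"
    by (rule definable_set_blocks[OF gr]) auto
  then have "definable_set M B (m + n) {y @ inv_into D g y | y. y \<in> g ` D}"
  proof (rule definable_set_cong)
    fix z
    assume "z \<in> {z. length z = m + n \<and> blocks [(m, n), (0, m)] (z @ []) \<in> {x @ g x | x. x \<in> D}}"
    then obtain x where z: "length z = m + n" and x: "drop m z @ take m z = x @ g x" "x \<in> D"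
      by auto
    then have "drop m z = x" "take m z = g x" using len[OF x(2)] by (auto simp: append_eq_append_conv)
    then have "z = g x @ inv_into D g (g x)" using inj x(2) by (metis append_take_drop_id inv_into_f_f)
    then show "z \<in> {y @ inv_into D g y | y. y \<in> g ` D}" using x(2) by blast
  next
    fix z assume "z \<in> {y @ inv_into D g y | y. y \<in> g ` D}"
    then obtain x where "x \<in> D" "z = g x @ x" using inj by auto
    then show "z \<in> {z. length z = m + n \<and>
      blocks [(m, n), (0, m)] (z @ []) \<in> {x @ g x | x. x \<in> D}}"
      using len[of x] by auto
  qed
  moreover have "\<forall>y\<in>g ` D. length y = m \<and> length (inv_into D g y) = n"
    using len inj by auto
  ultimately show ?thesis unfolding definable_map_iff by blast
qed

lemma definable_map_mono: "definable_map M B D g \<Longrightarrow> B \<subseteq> C \<Longrightarrow> definable_map M C D g"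
  unfolding definable_map_iff using definable_set_mono by blast

text \<open>The graph of a translation is a section of the graph of the multiplication, at the parameter
  \<open>c\<close>.\<close>

lemma definable_map_translations:
  assumes G: "definable_group M A G" and c: "c \<in> carrier G"
  shows "definable_map M UNIV (carrier G) (\<lambda>x. c \<otimes>\<^bsub>G\<^esub> x)"
    and "definable_map M UNIV (carrier G) (\<lambda>x. x \<otimes>\<^bsub>G\<^esub> c)"
proof -
  let ?R = "{x @ y @ (x \<otimes>\<^bsub>G\<^esub> y) | x y. x \<in> carrier G \<and> y \<in> carrier G}"
  from G obtain n where n: "definable_set M A n (carrier G)" and R: "definable_set M A (3 * n) ?R"
    and grp: "group G"
    unfolding definable_group_def by blast
  interpret group G by (rule grp)
  note len = definable_set_length[OF n]
  have R': "definable_set M UNIV (3 * n) ?R" by (rule definable_set_mono[OF R]) simp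
  have decomp: "x \<in> carrier G \<and> y \<in> carrier G \<and> z = x \<otimes>\<^bsub>G\<^esub> y"
    if "length x = n" "length y = n" "x @ y @ z \<in> ?R" for x y z
  proof -
    from that(3) obtain x' y' where *: "x' \<in> carrier G" "y' \<in> carrier G" "x @ y @ z = x' @ y' @ (x' \<otimes>\<^bsub>G\<^esub> y')"
      by blast
    then have "length x = length x'" "length y = length y'" using that len by simp_all
    with * show ?thesis by (metis append_eq_append_conv)
  qed
  have "definable_set M UNIV (n + n) {z. length z = n + n \<and>
      blocks [(n + n, n), (0, n), (n, n)] (z @ c) \<in> ?R}"
    by (rule definable_set_blocks[OF R']) (auto simp: len[OF c])
  then have "definable_set M UNIV (n + n) {x @ (c \<otimes>\<^bsub>G\<^esub> x) | x. x \<in> carrier G}"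
  proof (rule definable_set_cong)
    fix z assume asm: "z \<in> {z. length z = n + n \<and>
      blocks [(n + n, n), (0, n), (n, n)] (z @ c) \<in> ?R}"
    then have z: "length z = n + n" by blast
    have "c @ take n z @ drop n z \<in> ?R" using asm len[OF c] by (simp add: z)
    then have "take n z \<in> carrier G \<and> drop n z = c \<otimes>\<^bsub>G\<^esub> take n z"
      using decomp[of "c" "take n z" "drop n z"] len[OF c] z by simp
    then show "z \<in> {x @ (c \<otimes>\<^bsub>G\<^esub> x) | x. x \<in> carrier G}"
      by (metis (mono_tags, lifting) append_take_drop_id mem_Collect_eq)
  next
    fix z assume "z \<in> {x @ (c \<otimes>\<^bsub>G\<^esub> x) | x. x \<in> carrier G}"
    then show "z \<in> {z. length z = n + n \<and> blocks [(n + n, n), (0, n), (n, n)] (z @ c) \<in> ?R}"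
      using c by (clarsimp simp: len) blast
  qed
  then show "definable_map M UNIV (carrier G) (\<lambda>x. c \<otimes>\<^bsub>G\<^esub> x)"
    unfolding definable_map_iff using len c by (intro exI[of _ n]) auto
  have "definable_set M UNIV (n + n) {z. length z = n + n \<and>
      blocks [(0, n), (n + n, n), (n, n)] (z @ c) \<in> ?R}"
    by (rule definable_set_blocks[OF R']) (auto simp: len[OF c])
  then have "definable_set M UNIV (n + n) {x @ (x \<otimes>\<^bsub>G\<^esub> c) | x. x \<in> carrier G}"
  proof (rule definable_set_cong)
    fix z assume asm: "z \<in> {z. length z = n + n \<and>
      blocks [(0, n), (n + n, n), (n, n)] (z @ c) \<in> ?R}"
    then have z: "length z = n + n" by blast
    have "take n z @ c @ drop n z \<in> ?R" using asm len[OF c] by (simp add: z)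
    then have "take n z \<in> carrier G \<and> drop n z = take n z \<otimes>\<^bsub>G\<^esub> c"
      using decomp[of "take n z" "c" "drop n z"] len[OF c] z by simp
    then show "z \<in> {x @ (x \<otimes>\<^bsub>G\<^esub> c) | x. x \<in> carrier G}"
      by (metis (mono_tags, lifting) append_take_drop_id mem_Collect_eq)
  next
    fix z assume "z \<in> {x @ (x \<otimes>\<^bsub>G\<^esub> c) | x. x \<in> carrier G}"
    then show "z \<in> {z. length z = n + n \<and> blocks [(0, n), (n + n, n), (n, n)] (z @ c) \<in> ?R}"
      using c by (clarsimp simp: len) blast
  qed
  then show "definable_map M UNIV (carrier G) (\<lambda>x. x \<otimes>\<^bsub>G\<^esub> c)"
    unfolding definable_map_iff using len c by (intro exI[of _ n]) auto
qed

lemma definable_map_conj: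
  assumes G: "definable_group M A G" and N: "definable_set M A n N" "N \<subseteq> carrier G"
    and c: "c \<in> carrier G"
  shows "definable_map M UNIV N (\<lambda>x. c \<otimes>\<^bsub>G\<^esub> x \<otimes>\<^bsub>G\<^esub> inv\<^bsub>G\<^esub> c)"
proof -
  interpret group G using G by (simp add: definable_group_def)
  have "definable_map M UNIV (carrier G) (\<lambda>x. c \<otimes>\<^bsub>G\<^esub> x \<otimes>\<^bsub>G\<^esub> inv\<^bsub>G\<^esub> c)"
    by (rule definable_map_comp[OF definable_map_translations(2)[OF G] definable_map_translations(1)[OF G c]])
      (use c in auto)
  then show ?thesis
    by (rule definable_map_restrict_domain[OF _ definable_set_mono[OF N(1)] N(2)]) simp
qed

section \<open>The action of the automorphism group\<close>

lemma aut_rel_interp: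
  assumes "\<sigma> \<in> aut_over M A" and "(r, length xs) \<in> rels M"
  shows "rel_interp M r (map \<sigma> xs) \<longleftrightarrow> rel_interp M r xs"
proof -
  have "\<forall>(r, n)\<in>rels M. \<forall>xs. length xs = n \<longrightarrow> (rel_interp M r (map \<sigma> xs) \<longleftrightarrow> rel_interp M r xs)"
    using assms(1) unfolding aut_over_def by blast
  from bspec[OF this assms(2)] show ?thesis by simp
qed

lemma aut_eval_term:
  assumes "\<sigma> \<in> aut_over M A" and "wf_term M (length e) t"
  shows "eval_term M (map \<sigma> e) t = \<sigma> (eval_term M e t)"
  using assms(2)
proof (induction t)
  case (Fun f ts)
  have "map (eval_term M (map \<sigma> e)) ts = map \<sigma> (map (eval_term M e) ts)"
    using Fun by auto
  moreover have "\<sigma> (fun_interp M f (map (eval_term M e) ts))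
      = fun_interp M f (map \<sigma> (map (eval_term M e) ts))"
    using assms(1) Fun.prems unfolding aut_over_def by fastforce
  ultimately show ?case by (simp del: map_eq_conv map_map)
qed simp

lemma aut_sat:
  assumes \<sigma>: "\<sigma> \<in> aut_over M A" and "wf_formula M (length e) \<phi>"
  shows "sat M (map \<sigma> e) \<phi> \<longleftrightarrow> sat M e \<phi>"
  using assms(2)
proof (induction \<phi> arbitrary: e)
  case (Eq s t)
  then show ?case
    using \<sigma> by (auto simp: aut_eval_term[OF \<sigma>] aut_over_def dest: bij_is_inj injD)
next
  case (Rel R ts)
  have "map (eval_term M (map \<sigma> e)) ts = map \<sigma> (map (eval_term M e) ts)"
    using Rel by (auto simp: aut_eval_term[OF \<sigma>])
  moreover have "rel_interp M R (map \<sigma> (map (eval_term M e) ts))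
      \<longleftrightarrow> rel_interp M R (map (eval_term M e) ts)"
    by (rule aut_rel_interp[OF \<sigma>]) (use Rel.prems in simp)
  ultimately show ?case by (simp del: map_eq_conv map_map)
next
  case (Ex \<phi>)
  have "sat M (\<sigma> x # map \<sigma> e) \<phi> = sat M (x # e) \<phi>" for x
    using Ex.IH[of "x # e"] Ex.prems by simp
  moreover have "surj \<sigma>" using \<sigma> by (auto simp: aut_over_def bij_is_surj)
  ultimately show ?case by (metis sat.simps(5) surjD)
qed auto

text \<open>Automorphisms preserve the truth of formulas and fix the parameters in \<open>A\<close>.\<close>

lemma aut_definable_set:
  assumes \<sigma>: "\<sigma> \<in> aut_over M A" and X: "definable_set M A n X"
  shows "map \<sigma> x \<in> X \<longleftrightarrow> x \<in> X"
proof -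
  from X obtain \<phi> ps where
    ps: "set ps \<subseteq> A" "wf_formula M (n + length ps) \<phi>" "X = {x. length x = n \<and> sat M (x @ ps) \<phi>}"
    unfolding definable_set_def by blast
  have "map \<sigma> ps = ps" using \<sigma> ps(1) by (intro map_idI) (auto simp: aut_over_def)
  then have "sat M (map \<sigma> x @ ps) \<phi> \<longleftrightarrow> sat M (x @ ps) \<phi>" if "length x = n"
    using aut_sat[OF \<sigma>, of "x @ ps" \<phi>] ps(2) that by simp
  then show ?thesis using ps(3) by auto
qed

lemma id_aut_over: "id \<in> aut_over M A"
  by (auto simp: aut_over_def)

lemma comp_aut_over: "\<sigma> \<in> aut_over M A \<Longrightarrow> \<tau> \<in> aut_over M A \<Longrightarrow> \<sigma> \<circ> \<tau> \<in> aut_over M A"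
  unfolding aut_over_def by (simp add: bij_comp split_beta flip: map_map)

lemma map_aut_inv:
  assumes "\<sigma> \<in> aut_over M A"
  shows "map \<sigma> (map (inv_into UNIV \<sigma>) x) = x" and "map (inv_into UNIV \<sigma>) (map \<sigma> x) = x"
proof -
  have "bij \<sigma>" using assms by (auto simp: aut_over_def)
  then show "map \<sigma> (map (inv_into UNIV \<sigma>) x) = x" "map (inv_into UNIV \<sigma>) (map \<sigma> x) = x"
    by (simp_all add: bij_is_surj bij_is_inj surj_iff o_def surj_f_inv_f map_idI)
qed

lemma aut_image_definable_set:
  assumes "\<sigma> \<in> aut_over M A" and "definable_set M A n X"
  shows "map \<sigma> ` X = X"
proof
  show "map \<sigma> ` X \<subseteq> X" using aut_definable_set[OF assms] by blast
  show "X \<subseteq> map \<sigma> ` X"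
    using aut_definable_set[OF assms] map_aut_inv(1)[OF assms(1)] by (metis image_eqI subsetI)
qed

text \<open>The graph of the multiplication is invariant under automorphisms over \<open>A\<close>, and a triple in it
  determines its last component.\<close>

lemma aut_hom_definable_group:
  assumes \<sigma>: "\<sigma> \<in> aut_over M A" and G: "definable_group M A G"
  shows "map \<sigma> \<in> hom G G"
proof (rule homI)
  from G obtain n where n: "definable_set M A n (carrier G)"
    and mult: "definable_set M A (3 * n) {x @ y @ (x \<otimes>\<^bsub>G\<^esub> y) | x y. x \<in> carrier G \<and> y \<in> carrier G}"
    and grp: "group G"
    unfolding definable_group_def by blast
  show closed: "map \<sigma> x \<in> carrier G" if "x \<in> carrier G" for x
    using that aut_definable_set[OF \<sigma> n] by simp
  fix x y assume xy: "x \<in> carrier G" "y \<in> carrier G"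
  then have "map \<sigma> (x @ y @ (x \<otimes>\<^bsub>G\<^esub> y)) \<in> {x @ y @ (x \<otimes>\<^bsub>G\<^esub> y) | x y. x \<in> carrier G \<and> y \<in> carrier G}"
    unfolding aut_definable_set[OF \<sigma> mult] by blast
  then obtain x' y' where xy': "x' \<in> carrier G" "y' \<in> carrier G"
    and eq: "map \<sigma> x @ map \<sigma> y @ map \<sigma> (x \<otimes>\<^bsub>G\<^esub> y) = x' @ y' @ (x' \<otimes>\<^bsub>G\<^esub> y')"
    by auto
  have "length (map \<sigma> x) = length x'" "length (map \<sigma> y) = length y'"
    using definable_set_length[OF n] xy xy' by simp_all
  then show "map \<sigma> (x \<otimes>\<^bsub>G\<^esub> y) = map \<sigma> x \<otimes>\<^bsub>G\<^esub> map \<sigma> y"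
    using eq by (metis append_eq_append_conv)
qed

section \<open>Definable cochains\<close>

text \<open>Every definable relation restricts to a definable partial function on the set of arguments that
  are related to exactly one value. A related pair has to be discarded exactly if its argument
  is related to a second value, and this is a projection of a definable set. This makes a function out of a formula that is only known to be functional
  for some values of its parameters.\<close>

lemma definable_pfun_unique:
  assumes R: "definable_set M B (n + m) R"
  shows "definable_pfun M B n m
           (\<lambda>x. if length x = n \<and> (\<exists>!y. x @ y \<in> R) then Some (THE y. x @ y \<in> R) else None)"
proof -
  define h where "h = (\<lambda>x. if length x = n \<and> (\<exists>!y. x @ y \<in> R) then Some (THE y. x @ y \<in> R) else None)"
  have len: "length y = m" if "x @ y \<in> R" "length x = n" for x y
    using definable_set_length[OF R that(1)] that(2) by simp
  have h: "h x = Some y \<longleftrightarrow> length x = n \<and> x @ y \<in> R \<and> (\<forall>y'. x @ y' \<in> R \<longrightarrow> y' = y)" for x y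
    unfolding h_def by (auto intro: the_equality theI2)
  let ?X = "{z. length z = m + (n + m) \<and> blocks [(m, n), (0, m)] (z @ []) \<in> R}"
  let ?Y = "{z. length z = m + (n + m) \<and>
      z \<notin> {z. length z = m + (n + m) \<and> take m (drop 0 z) = take m (drop (m + n) z)}}"
  have "definable_set M B (m + (n + m)) ?X"
    by (rule definable_set_blocks[OF R]) auto
  moreover have "definable_set M B (m + (n + m)) ?Y"
    by (rule definable_set_compl, rule definable_set_eq_blocks) auto
  ultimately have "definable_set M B (n + m) (R \<inter> {v. length v = n + m \<and>
      v \<notin> {v. length v = n + m \<and> (\<exists>y'. length y' = m \<and> y' @ v \<in> ?X \<inter> ?Y)}})"
    by (intro definable_set_Int[OF R] definable_set_compl[OF definable_set_proj[OF definable_set_Int]])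
  then have "definable_set M B (n + m) {x @ y | x y. h x = Some y}"
  proof (rule definable_set_cong)
    fix v assume v: "v \<in> R \<inter> {v. length v = n + m \<and>
      v \<notin> {v. length v = n + m \<and> (\<exists>y'. length y' = m \<and> y' @ v \<in> ?X \<inter> ?Y)}}"
    have "y' = drop n v" if "take n v @ y' \<in> R" for y'
      using len[OF that] v that by auto
    then have "h (take n v) = Some (drop n v)" unfolding h using v by auto
    then show "v \<in> {x @ y | x y. h x = Some y}" by (intro CollectI exI[of _ "take n v"] exI[of _ "drop n v"]) simp
  next
    fix v assume "v \<in> {x @ y | x y. h x = Some y}"
    then obtain x y where v: "v = x @ y" and x: "length x = n" and R_v: "x @ y \<in> R"
      and uniq: "\<And>y'. x @ y' \<in> R \<Longrightarrow> y' = y"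
      unfolding h by blast
    have y: "length y = m" by (rule len[OF R_v x])
    have "\<not> (length y' = m \<and> y' @ v \<in> ?X \<inter> ?Y)" for y'
    proof
      assume y': "length y' = m \<and> y' @ v \<in> ?X \<inter> ?Y"
      then have len_y': "length y' = m" by blast
      have "x @ y' \<in> R" using y' x y by (simp add: v len_y')
      then have "y' = y" by (rule uniq)
      then show False using y' x y by (simp add: v)
    qed
    then have no_other: "v \<notin> {v. length v = n + m \<and> (\<exists>y'. length y' = m \<and> y' @ v \<in> ?X \<inter> ?Y)}"
      by (intro notI) (elim CollectE conjE exE, blast)
    have "v \<in> R" "length v = n + m" using R_v x y v by simp_all
    then show "v \<in> R \<inter> {v. length v = n + m \<and>
      v \<notin> {v. length v = n + m \<and> (\<exists>y'. length y' = m \<and> y' @ v \<in> ?X \<inter> ?Y)}}"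
      by (intro IntI CollectI conjI no_other)
  qed
  then show ?thesis unfolding h_def[symmetric] definable_pfun_def using h len by blast
qed

text \<open>The parameters \<open>c\<close> of \<open>g\<close> are prepended to the tuple \<open>a\<close> of the cochain, which makes
  \<open>g (\<Phi> \<sigma>)\<close> a function of \<open>c @ a\<close> and \<open>map \<sigma> (c @ a)\<close> that is definable without further parameters
  outside \<open>A\<close>. The relation \<open>R\<close> below says \<open>\<exists>w. h(a, a') = w \<and> \<phi>(w, y, c)\<close> at
  \<open>(c, a, c', a', y)\<close>, where \<open>\<phi>\<close> is a formula that defines the graph of \<open>g\<close>.\<close>

lemma definable_cochain_compose:
  assumes \<Phi>: "definable_cochain M A \<Phi>" and g: "definable_map M UNIV D g"
    and D: "\<And>\<sigma>. \<sigma> \<in> aut_over M A \<Longrightarrow> \<Phi> \<sigma> \<in> D"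
  shows "definable_cochain M A (compose (aut_over M A) g \<Phi>)"
proof -
  from \<Phi> obtain a k h where h: "definable_pfun M A (length a + length a) k h"
    and h\<Phi>: "\<And>\<sigma>. \<sigma> \<in> aut_over M A \<Longrightarrow> h (a @ map \<sigma> a) = Some (\<Phi> \<sigma>)"
    unfolding definable_cochain_def by blast
  from g obtain n m where len: "\<And>x. x \<in> D \<Longrightarrow> length x = n \<and> length (g x) = m"
    and gr: "definable_set M UNIV (n + m) {x @ g x | x. x \<in> D}"
    unfolding definable_map_iff by blast
  \<comment> \<open>the values of \<open>h\<close> and the arguments of \<open>g\<close> have the same length
    because some value of \<open>\<Phi>\<close>, at the identity, exists\<close>
  have "length (\<Phi> id) = k" using h h\<Phi>[OF id_aut_over] unfolding definable_pfun_def by blast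
  then have k: "k = n" using len[OF D[OF id_aut_over]] by simp
  define \<Gamma> where "\<Gamma> = {x @ y | x y. h x = Some y}"
  have \<Gamma>: "definable_set M A (length a + length a + n) \<Gamma>"
    and h_len: "\<And>x y. h x = Some y \<Longrightarrow> length x = length a + length a \<and> length y = n"
    using h unfolding definable_pfun_def k \<Gamma>_def by blast+
  from gr obtain \<phi> c where wf: "wf_formula M (n + m + length c) \<phi>"
    and gr_eq: "{x @ g x | x. x \<in> D} = {z. length z = n + m \<and> sat M (z @ c) \<phi>}"
    unfolding definable_set_def by blast
  define p q where "p = length a" and "q = length c"
  \<comment> \<open>the graph of \<open>g\<close> with its parameters turned into variables: definable over the
    empty set\<close>
  define X where "X = {z. length z = n + m + q \<and> sat M z \<phi>}"
  have X: "definable_set M A (n + m + q) X"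
    unfolding X_def q_def by (rule definable_set_formula[OF wf])
  let ?d = "(q + p) + (q + p) + m"
  define U where "U = {z. length z = n + ?d \<and>
      blocks [(n + q, p), (n + q + p + q, p), (0, n)] (z @ []) \<in> \<Gamma>}"
  define V where "V = {z. length z = n + ?d \<and>
      blocks [(0, n), (n + (q + p) + (q + p), m), (n, q)] (z @ []) \<in> X}"
  define R where "R = {v. length v = ?d \<and> (\<exists>w. length w = n \<and> w @ v \<in> U \<inter> V)}"
  have "definable_set M A (n + ?d) U"
    unfolding U_def by (rule definable_set_blocks[OF \<Gamma>]) (auto simp: p_def)
  moreover have "definable_set M A (n + ?d) V"
    unfolding V_def by (rule definable_set_blocks[OF X]) auto
  ultimately have "definable_set M A ?d R"
    unfolding R_def by (intro definable_set_proj definable_set_Int)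
  then have "definable_set M A (length (c @ a) + length (c @ a) + m) R"
    by (simp add: p_def q_def)
  note pfun = definable_pfun_unique[OF this]
  have R_iff: "(c @ a) @ map \<sigma> (c @ a) @ y \<in> R \<longleftrightarrow> y = g (\<Phi> \<sigma>)" if \<sigma>: "\<sigma> \<in> aut_over M A" for \<sigma> y
  proof -
    have \<Gamma>_iff: "a @ map \<sigma> a @ w \<in> \<Gamma> \<longleftrightarrow> w = \<Phi> \<sigma>" for w
    proof
      assume "a @ map \<sigma> a @ w \<in> \<Gamma>"
      then obtain x y where "(a @ map \<sigma> a) @ w = x @ y" "h x = Some y"
        unfolding \<Gamma>_def by auto
      moreover from this have "length x = length (a @ map \<sigma> a)" using h_len by simp
      ultimately show "w = \<Phi> \<sigma>" using h\<Phi>[OF \<sigma>] by (metis append_eq_append_conv option.inject)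
    next
      assume "w = \<Phi> \<sigma>"
      then show "a @ map \<sigma> a @ w \<in> \<Gamma>" unfolding \<Gamma>_def using h\<Phi>[OF \<sigma>]
        by (intro CollectI exI[of _ "a @ map \<sigma> a"] exI[of _ "\<Phi> \<sigma>"]) simp
    qed
    have X_iff: "\<Phi> \<sigma> @ y @ c \<in> X \<longleftrightarrow> y = g (\<Phi> \<sigma>)"
    proof -
      have "\<Phi> \<sigma> @ y @ c \<in> X \<longleftrightarrow> \<Phi> \<sigma> @ y \<in> {x @ g x | x. x \<in> D}"
        unfolding gr_eq by (simp add: X_def q_def)
      also have "\<dots> \<longleftrightarrow> y = g (\<Phi> \<sigma>)"
      proof
        assume "\<Phi> \<sigma> @ y \<in> {x @ g x | x. x \<in> D}"
        then obtain x where "\<Phi> \<sigma> @ y = x @ g x" "x \<in> D" by blast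
        moreover from this have "length (\<Phi> \<sigma>) = length x" using len D[OF \<sigma>] by simp
        ultimately show "y = g (\<Phi> \<sigma>)" by simp
      qed (use D[OF \<sigma>] in blast)
      finally show ?thesis .
    qed
    have "w @ (c @ a) @ map \<sigma> (c @ a) @ y \<in> U \<inter> V \<longleftrightarrow>
        length y = m \<and> a @ map \<sigma> a @ w \<in> \<Gamma> \<and> w @ y @ c \<in> X" if "length w = n" for w
      by (cases "length y = m") (simp_all add: that U_def V_def p_def q_def)
    then have "(c @ a) @ map \<sigma> (c @ a) @ y \<in> R \<longleftrightarrow>
        length y = m \<and> (\<exists>w. length w = n \<and> a @ map \<sigma> a @ w \<in> \<Gamma> \<and> w @ y @ c \<in> X)"
      unfolding R_def by (auto simp: p_def q_def)
    also have "\<dots> \<longleftrightarrow> y = g (\<Phi> \<sigma>)"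
      unfolding \<Gamma>_iff using X_iff len[OF D[OF \<sigma>]] by auto
    finally show ?thesis .
  qed
  show ?thesis
    unfolding definable_cochain_def
  proof (intro exI conjI ballI, rule pfun)
    fix \<sigma> assume \<sigma>: "\<sigma> \<in> aut_over M A"
    then have "((c @ a) @ map \<sigma> (c @ a)) @ y \<in> R \<longleftrightarrow> y = compose (aut_over M A) g \<Phi> \<sigma>" for y
      using R_iff[OF \<sigma>, of y] by (simp add: compose_eq)
    then show "(if length ((c @ a) @ map \<sigma> (c @ a)) = length (c @ a) + length (c @ a)
          \<and> (\<exists>!y. ((c @ a) @ map \<sigma> (c @ a)) @ y \<in> R)
        then Some (THE y. ((c @ a) @ map \<sigma> (c @ a)) @ y \<in> R) else None)
      = Some (compose (aut_over M A) g \<Phi> \<sigma>)"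
      by (simp del: append_assoc)
  qed
qed

section \<open>Transport of cohomology along an equivariant isomorphism\<close>

text \<open>The cocycle condition and the coboundary relation are equations between products of values and
  of their images under \<open>act\<close>. An equivariant isomorphism \<open>f\<close> carries such an equation in \<open>K\<close> to the
  corresponding one in \<open>K'\<close> and reflects it, and post-composition with \<open>f\<close> preserves and reflects
  definability even if \<open>f\<close> needs parameters outside \<open>A\<close>. Hence it maps classes onto classes.\<close>

locale equivariant_definable_iso = K: group K + K': group K'
  for K :: "'a list monoid" and K' :: "'a list monoid" +
  fixes M :: "('f, 'r, 'a) fo_structure" and A :: "'a set"
    and act act' :: "('a \<Rightarrow> 'a) \<Rightarrow> 'a list \<Rightarrow> 'a list" and f :: "'a list \<Rightarrow> 'a list"
  assumes iso: "f \<in> definable_iso M K K'"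
    and act_closed: "\<And>\<sigma> x. \<sigma> \<in> aut_over M A \<Longrightarrow> x \<in> carrier K \<Longrightarrow> act \<sigma> x \<in> carrier K"
    and equivariant: "\<And>\<sigma> x. \<sigma> \<in> aut_over M A \<Longrightarrow> x \<in> carrier K \<Longrightarrow> f (act \<sigma> x) = act' \<sigma> (f x)"
begin

abbreviation push :: "(('a \<Rightarrow> 'a) \<Rightarrow> 'a list) \<Rightarrow> ('a \<Rightarrow> 'a) \<Rightarrow> 'a list"
  where "push \<equiv> compose (aut_over M A) f"

lemma bij: "bij_betw f (carrier K) (carrier K')" and hom: "f \<in> hom K K'"
  and definable: "definable_map M UNIV (carrier K) f"
  using iso by (auto simp: definable_iso_def iso_def)

lemma iso_closed: "x \<in> carrier K \<Longrightarrow> f x \<in> carrier K'"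
  using bij by (rule bij_betw_apply)

lemma iso_eq_iff: "x \<in> carrier K \<Longrightarrow> y \<in> carrier K \<Longrightarrow> f x = f y \<longleftrightarrow> x = y"
  using bij by (auto simp: bij_betw_def inj_on_def)

lemma iso_mult: "x \<in> carrier K \<Longrightarrow> y \<in> carrier K \<Longrightarrow> f (x \<otimes>\<^bsub>K\<^esub> y) = f x \<otimes>\<^bsub>K'\<^esub> f y"
  using hom by (rule hom_mult)

lemma iso_inv: "x \<in> carrier K \<Longrightarrow> f (inv\<^bsub>K\<^esub> x) = inv\<^bsub>K'\<^esub> f x"
  by (rule group_hom.hom_inv) (unfold_locales, rule hom)

lemma push_bij: "bij_betw push (aut_over M A \<rightarrow>\<^sub>E carrier K) (aut_over M A \<rightarrow>\<^sub>E carrier K')"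
proof (rule bij_betw_byWitness[where f' = "compose (aut_over M A) (inv_into (carrier K) f)"])
  show "push ` (aut_over M A \<rightarrow>\<^sub>E carrier K) \<subseteq> aut_over M A \<rightarrow>\<^sub>E carrier K'"
    using iso_closed by (auto simp: compose_def dest: PiE_mem)
  show "compose (aut_over M A) (inv_into (carrier K) f) ` (aut_over M A \<rightarrow>\<^sub>E carrier K')
      \<subseteq> aut_over M A \<rightarrow>\<^sub>E carrier K"
    using bij_betw_apply[OF bij_betw_inv_into[OF bij]] by (auto simp: compose_def dest: PiE_mem)
  show "\<forall>\<Psi>\<in>aut_over M A \<rightarrow>\<^sub>E carrier K. compose (aut_over M A) (inv_into (carrier K) f) (push \<Psi>) = \<Psi>"
    by (intro ballI extensionalityI[of _ "aut_over M A"])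
      (auto simp: compose_eq bij_betw_inv_into_left[OF bij] PiE_iff)
  show "\<forall>\<Psi>\<in>aut_over M A \<rightarrow>\<^sub>E carrier K'. push (compose (aut_over M A) (inv_into (carrier K) f) \<Psi>) = \<Psi>"
    by (intro ballI extensionalityI[of _ "aut_over M A"])
      (auto simp: compose_eq bij_betw_inv_into_right[OF bij] PiE_iff)
qed

lemma push_cocycle_iff:
  assumes \<Psi>: "\<Psi> \<in> aut_over M A \<rightarrow>\<^sub>E carrier K"
  shows "push \<Psi> \<in> cocycles (aut_over M A) act' K' \<longleftrightarrow> \<Psi> \<in> cocycles (aut_over M A) act K"
proof -
  have "push \<Psi> (\<sigma> \<circ> \<tau>) = push \<Psi> \<sigma> \<otimes>\<^bsub>K'\<^esub> act' \<sigma> (push \<Psi> \<tau>)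
      \<longleftrightarrow> \<Psi> (\<sigma> \<circ> \<tau>) = \<Psi> \<sigma> \<otimes>\<^bsub>K\<^esub> act \<sigma> (\<Psi> \<tau>)"
    if \<sigma>: "\<sigma> \<in> aut_over M A" and \<tau>: "\<tau> \<in> aut_over M A" for \<sigma> \<tau>
  proof -
    have in_K: "\<Psi> \<sigma> \<in> carrier K" "\<Psi> \<tau> \<in> carrier K" "\<Psi> (\<sigma> \<circ> \<tau>) \<in> carrier K"
      using \<Psi> \<sigma> \<tau> comp_aut_over[OF \<sigma> \<tau>] by (auto dest: PiE_mem)
    have "push \<Psi> \<sigma> \<otimes>\<^bsub>K'\<^esub> act' \<sigma> (push \<Psi> \<tau>) = f (\<Psi> \<sigma> \<otimes>\<^bsub>K\<^esub> act \<sigma> (\<Psi> \<tau>))"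
      using \<sigma> \<tau> in_K by (simp add: compose_eq iso_mult act_closed equivariant)
    moreover have "push \<Psi> (\<sigma> \<circ> \<tau>) = f (\<Psi> (\<sigma> \<circ> \<tau>))"
      using comp_aut_over[OF \<sigma> \<tau>] by (simp add: compose_eq)
    ultimately show ?thesis using in_K \<sigma> by (simp add: iso_eq_iff act_closed)
  qed
  moreover have "push \<Psi> \<in> aut_over M A \<rightarrow>\<^sub>E carrier K'"
    using bij_betw_apply[OF push_bij \<Psi>] .
  ultimately show ?thesis using \<Psi> unfolding cocycles_def by auto
qed

lemma push_definable_iff:
  assumes \<Psi>: "\<Psi> \<in> aut_over M A \<rightarrow>\<^sub>E carrier K"
  shows "definable_cochain M A (push \<Psi>) \<longleftrightarrow> definable_cochain M A \<Psi>"
proof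
  assume "definable_cochain M A \<Psi>"
  then show "definable_cochain M A (push \<Psi>)"
    by (rule definable_cochain_compose[OF _ definable]) (use \<Psi> in \<open>auto dest: PiE_mem\<close>)
next
  assume push: "definable_cochain M A (push \<Psi>)"
  have "definable_map M UNIV (f ` carrier K) (inv_into (carrier K) f)"
    using definable bij by (intro definable_map_inv_into) (auto simp: bij_betw_def)
  then have "definable_cochain M A (compose (aut_over M A) (inv_into (carrier K) f) (push \<Psi>))"
    by (rule definable_cochain_compose[OF push]) (use \<Psi> in \<open>auto simp: compose_eq dest: PiE_mem\<close>)
  moreover have "compose (aut_over M A) (inv_into (carrier K) f) (push \<Psi>) = \<Psi>"
    using \<Psi> by (intro extensionalityI[of _ "aut_over M A"])
      (auto simp: compose_eq bij_betw_inv_into_left[OF bij] PiE_iff)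
  ultimately show "definable_cochain M A \<Psi>" by simp
qed

lemma push_Z1_iff:
  "\<Psi> \<in> aut_over M A \<rightarrow>\<^sub>E carrier K \<Longrightarrow> push \<Psi> \<in> Z1_def M A act' K' \<longleftrightarrow> \<Psi> \<in> Z1_def M A act K"
  unfolding Z1_def_def using push_cocycle_iff push_definable_iff by blast

lemma Z1_subset: "Z1_def M A act K \<subseteq> aut_over M A \<rightarrow>\<^sub>E carrier K"
  unfolding Z1_def_def cocycles_def by blast

lemma Z1_subset': "Z1_def M A act' K' \<subseteq> aut_over M A \<rightarrow>\<^sub>E carrier K'"
  unfolding Z1_def_def cocycles_def by blast

text \<open>As \<open>b\<close> ranges over \<open>K\<close>, \<open>f b\<close> ranges over all of \<open>K'\<close>, so it suffices to compare the coboundary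
  by \<open>b\<close> with the coboundary by \<open>f b\<close>.\<close>

lemma push_cohomologous_iff:
  assumes \<Psi>: "\<Psi> \<in> aut_over M A \<rightarrow>\<^sub>E carrier K" and \<Theta>: "\<Theta> \<in> aut_over M A \<rightarrow>\<^sub>E carrier K"
  shows "(push \<Psi>, push \<Theta>) \<in> cohomologous (aut_over M A) act' K' (Z1_def M A act' K')
    \<longleftrightarrow> (\<Psi>, \<Theta>) \<in> cohomologous (aut_over M A) act K (Z1_def M A act K)"
proof -
  have "push \<Theta> \<sigma> = inv\<^bsub>K'\<^esub> f b \<otimes>\<^bsub>K'\<^esub> push \<Psi> \<sigma> \<otimes>\<^bsub>K'\<^esub> act' \<sigma> (f b)
      \<longleftrightarrow> \<Theta> \<sigma> = inv\<^bsub>K\<^esub> b \<otimes>\<^bsub>K\<^esub> \<Psi> \<sigma> \<otimes>\<^bsub>K\<^esub> act \<sigma> b"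
    if \<sigma>: "\<sigma> \<in> aut_over M A" and b: "b \<in> carrier K" for \<sigma> b
  proof -
    have in_K: "\<Psi> \<sigma> \<in> carrier K" "\<Theta> \<sigma> \<in> carrier K" "act \<sigma> b \<in> carrier K"
      using \<Psi> \<Theta> \<sigma> b act_closed by (auto dest: PiE_mem)
    have "inv\<^bsub>K'\<^esub> f b \<otimes>\<^bsub>K'\<^esub> push \<Psi> \<sigma> \<otimes>\<^bsub>K'\<^esub> act' \<sigma> (f b)
        = f (inv\<^bsub>K\<^esub> b \<otimes>\<^bsub>K\<^esub> \<Psi> \<sigma> \<otimes>\<^bsub>K\<^esub> act \<sigma> b)"
      using \<sigma> b in_K by (simp add: compose_eq iso_mult iso_inv equivariant)
    then show ?thesis using \<sigma> b in_K by (simp add: compose_eq iso_eq_iff)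
  qed
  then have "(\<exists>b'\<in>carrier K'. \<forall>\<sigma>\<in>aut_over M A.
        push \<Theta> \<sigma> = inv\<^bsub>K'\<^esub> b' \<otimes>\<^bsub>K'\<^esub> push \<Psi> \<sigma> \<otimes>\<^bsub>K'\<^esub> act' \<sigma> b')
      \<longleftrightarrow> (\<exists>b\<in>carrier K. \<forall>\<sigma>\<in>aut_over M A. \<Theta> \<sigma> = inv\<^bsub>K\<^esub> b \<otimes>\<^bsub>K\<^esub> \<Psi> \<sigma> \<otimes>\<^bsub>K\<^esub> act \<sigma> b)"
    unfolding bij_betw_imp_surj_on[OF bij, symmetric] by simp
  then show ?thesis
    using push_Z1_iff[OF \<Psi>] push_Z1_iff[OF \<Theta>] unfolding cohomologous_def by simp
qed

text \<open>Stated for all cochains, so that it covers the trivial one directly: if \<open>\<Psi>\<close> is not a definable cocycle, both sides are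
  empty.\<close>

lemma push_class:
  assumes \<Psi>: "\<Psi> \<in> aut_over M A \<rightarrow>\<^sub>E carrier K"
  shows "push ` H1_class M A act K \<Psi> = H1_class M A act' K' (push \<Psi>)"
proof (intro equalityI subsetI)
  fix \<Theta>' assume "\<Theta>' \<in> push ` H1_class M A act K \<Psi>"
  then obtain \<Theta> where \<Theta>: "(\<Psi>, \<Theta>) \<in> cohomologous (aut_over M A) act K (Z1_def M A act K)"
    and eq: "\<Theta>' = push \<Theta>"
    unfolding H1_class_def by blast
  then have "\<Theta> \<in> aut_over M A \<rightarrow>\<^sub>E carrier K" using Z1_subset unfolding cohomologous_def by blast
  then show "\<Theta>' \<in> H1_class M A act' K' (push \<Psi>)"
    unfolding H1_class_def eq using push_cohomologous_iff[OF \<Psi>] \<Theta> by blast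
next
  fix \<Theta>' assume "\<Theta>' \<in> H1_class M A act' K' (push \<Psi>)"
  then have \<Theta>': "(push \<Psi>, \<Theta>') \<in> cohomologous (aut_over M A) act' K' (Z1_def M A act' K')"
    unfolding H1_class_def by blast
  then have "\<Theta>' \<in> aut_over M A \<rightarrow>\<^sub>E carrier K'" using Z1_subset' unfolding cohomologous_def by blast
  then obtain \<Theta> where \<Theta>: "\<Theta> \<in> aut_over M A \<rightarrow>\<^sub>E carrier K" "\<Theta>' = push \<Theta>"
    using push_bij unfolding bij_betw_def by blast
  then show "\<Theta>' \<in> push ` H1_class M A act K \<Psi>"
    unfolding H1_class_def using push_cohomologous_iff[OF \<Psi> \<Theta>(1)] \<Theta>' by blast
qed

lemma H1_eq: "H1_def M A act K = H1_class M A act K ` Z1_def M A act K"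
  unfolding H1_def_def quotient_def H1_class_def by blast

text \<open>Injectivity is inherited from cochains, since a cohomology class is a set of cochains and taking
  images under an injection is injective.\<close>

lemma push_H1_bij:
  "bij_betw ((`) push) (H1_def M A act K) (H1_def M A act' K')"
proof -
  have "H1_def M A act K \<subseteq> Pow (aut_over M A \<rightarrow>\<^sub>E carrier K)"
    using Z1_subset unfolding H1_def_def quotient_def cohomologous_def by blast
  moreover have "inj_on ((`) push) (Pow (aut_over M A \<rightarrow>\<^sub>E carrier K))"
    using push_bij by (auto simp: bij_betw_def intro: inj_on_image_Pow)
  ultimately have "inj_on ((`) push) (H1_def M A act K)" by (rule inj_on_subset[rotated])
  moreover have "(`) push ` H1_def M A act K = H1_def M A act' K'"
  proof -
    have Z: "push ` Z1_def M A act K = Z1_def M A act' K'"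
    proof (intro equalityI subsetI)
      fix \<Theta>' assume "\<Theta>' \<in> Z1_def M A act' K'"
      moreover from this obtain \<Theta> where "\<Theta> \<in> aut_over M A \<rightarrow>\<^sub>E carrier K" "\<Theta>' = push \<Theta>"
        using push_bij Z1_subset' unfolding bij_betw_def by blast
      ultimately show "\<Theta>' \<in> push ` Z1_def M A act K" using push_Z1_iff by blast
    qed (use push_Z1_iff Z1_subset in blast)
    have "(`) push ` H1_def M A act K = (\<lambda>\<Psi>. H1_class M A act' K' (push \<Psi>)) ` Z1_def M A act K"
      unfolding H1_eq image_image using push_class Z1_subset by (intro image_cong) blast+
    also have "\<dots> = H1_class M A act' K' ` Z1_def M A act' K'"
      unfolding Z[symmetric] image_image ..
    also have "\<dots> = H1_def M A act' K'"
      unfolding H1_def_def quotient_def H1_class_def by blast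
    finally show ?thesis .
  qed
  ultimately show ?thesis by (simp add: bij_betw_def)
qed

lemma push_base: "push ` H1_base M A act K = H1_base M A act' K'"
proof -
  have "push (\<lambda>\<sigma>\<in>aut_over M A. \<one>\<^bsub>K\<^esub>) = (\<lambda>\<sigma>\<in>aut_over M A. \<one>\<^bsub>K'\<^esub>)"
    using hom_one[OF hom K.is_group K'.is_group] by (auto simp: compose_def)
  moreover have "(\<lambda>\<sigma>\<in>aut_over M A. \<one>\<^bsub>K\<^esub>) \<in> aut_over M A \<rightarrow>\<^sub>E carrier K" by auto
  ultimately show ?thesis unfolding H1_base_def using push_class by metis
qed

end

section \<open>Definable isomorphisms and automorphisms\<close>

lemma definable_iso_comp:
  assumes g: "g \<in> definable_iso M H K" and f: "f \<in> definable_iso M K L"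
  shows "(\<lambda>x. f (g x)) \<in> definable_iso M H L"
proof -
  have "f \<circ> g \<in> iso H L" using f g by (auto simp: definable_iso_def intro: iso_set_trans)
  moreover have "definable_map M UNIV (carrier H) (\<lambda>x. f (g x))"
    by (rule definable_map_comp[of M UNIV "carrier K"])
      (use f g in \<open>auto simp: definable_iso_def iso_def bij_betw_def\<close>)
  ultimately show ?thesis by (simp add: definable_iso_def comp_def)
qed

lemma definable_iso_inv:
  assumes "group H" and g: "g \<in> definable_iso M H K"
  shows "inv_into (carrier H) g \<in> definable_iso M K H"
proof -
  have "bij_betw g (carrier H) (carrier K)" using g by (simp add: definable_iso_def iso_def)
  then have "definable_map M UNIV (carrier K) (inv_into (carrier H) g)"
    using definable_map_inv_into[of M UNIV "carrier H" g] g
    by (simp add: bij_betw_def definable_iso_def)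
  then show ?thesis using group.iso_set_sym[OF assms(1)] g by (auto simp: definable_iso_def)
qed

lemma conj_definable_iso:
  assumes G: "definable_group M A G" and normal: "N \<lhd> G" and N: "definable_set M A n N"
    and c: "c \<in> carrier G"
  shows "(\<lambda>x. c \<otimes>\<^bsub>G\<^esub> x \<otimes>\<^bsub>G\<^esub> inv\<^bsub>G\<^esub> c) \<in> definable_iso M (G\<lparr>carrier := N\<rparr>) (G\<lparr>carrier := N\<rparr>)"
    (is "?\<kappa> \<in> _")
proof -
  interpret normal N G by (rule normal)
  have "?\<kappa> \<in> hom (G\<lparr>carrier := N\<rparr>) (G\<lparr>carrier := N\<rparr>)"
  proof (rule homI)
    fix x y assume "x \<in> carrier (G\<lparr>carrier := N\<rparr>)" "y \<in> carrier (G\<lparr>carrier := N\<rparr>)"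
    then have [simp]: "x \<in> carrier G" "y \<in> carrier G" using subset by auto
    have "inv\<^bsub>G\<^esub> c \<otimes>\<^bsub>G\<^esub> (c \<otimes>\<^bsub>G\<^esub> (y \<otimes>\<^bsub>G\<^esub> inv\<^bsub>G\<^esub> c)) = y \<otimes>\<^bsub>G\<^esub> inv\<^bsub>G\<^esub> c"
      using c by (simp flip: m_assoc)
    then show "?\<kappa> (x \<otimes>\<^bsub>G\<lparr>carrier := N\<rparr>\<^esub> y) = ?\<kappa> x \<otimes>\<^bsub>G\<lparr>carrier := N\<rparr>\<^esub> ?\<kappa> y"
      using c by (simp add: m_assoc)
  qed (use inv_op_closed2[OF c] in simp)
  moreover have "bij_betw ?\<kappa> N N"
  proof (rule bij_betw_byWitness[where f' = "\<lambda>x. inv\<^bsub>G\<^esub> c \<otimes>\<^bsub>G\<^esub> x \<otimes>\<^bsub>G\<^esub> c"])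
    show "\<forall>x\<in>N. inv\<^bsub>G\<^esub> c \<otimes>\<^bsub>G\<^esub> ?\<kappa> x \<otimes>\<^bsub>G\<^esub> c = x"
      using c by (auto simp: m_assoc) (simp flip: m_assoc)
    show "\<forall>x\<in>N. ?\<kappa> (inv\<^bsub>G\<^esub> c \<otimes>\<^bsub>G\<^esub> x \<otimes>\<^bsub>G\<^esub> c) = x"
      using c by (auto simp: m_assoc) (simp flip: m_assoc)
  qed (use c inv_op_closed1 inv_op_closed2 in auto)
  ultimately show ?thesis
    using definable_map_conj[OF G N subset c] by (simp add: definable_iso_def iso_def)
qed

text \<open>Inverses and products in \<open>Aut_def M N\<close> can therefore be computed in the group of all bijections
  of \<open>N\<close>.\<close>

lemma Aut_def_subgroup:
  assumes N: "group N" "definable_set M B n (carrier N)"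
  shows "subgroup (carrier (Aut_def M N)) (BijGroup (carrier N))"
proof -
  interpret N: group N by (rule N)
  interpret subgroup "auto N" "BijGroup (carrier N)" by (rule N.subgroup_auto)
  have mem: "\<phi> \<in> carrier (Aut_def M N) \<longleftrightarrow> \<phi> \<in> auto N \<and> definable_map M UNIV (carrier N) \<phi>" for \<phi>
    by (auto simp: Aut_def_def)
  have Bij: "\<phi> \<in> Bij (carrier N)" if "\<phi> \<in> auto N" for \<phi>
    using that by (simp add: auto_def)
  show ?thesis
  proof
    show "carrier (Aut_def M N) \<subseteq> carrier (BijGroup (carrier N))" using subset by (auto simp: mem)
    show "\<one>\<^bsub>BijGroup (carrier N)\<^esub> \<in> carrier (Aut_def M N)"
      using one_closed definable_map_mono[OF definable_map_id[OF N(2)], of UNIV]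
      by (auto simp: mem BijGroup_def intro: definable_map_cong)
  next
    fix \<phi> \<psi> assume "\<phi> \<in> carrier (Aut_def M N)" "\<psi> \<in> carrier (Aut_def M N)"
    then have *: "\<phi> \<in> auto N" "\<psi> \<in> auto N" "definable_map M UNIV (carrier N) \<phi>"
      "definable_map M UNIV (carrier N) \<psi>" by (auto simp: mem)
    have "definable_map M UNIV (carrier N) (\<lambda>x. \<phi> (\<psi> x))"
      by (rule definable_map_comp[of M UNIV "carrier N"])
        (use * Bij_imp_funcset[OF Bij[OF *(2)]] in auto)
    then have "definable_map M UNIV (carrier N) (\<phi> \<otimes>\<^bsub>BijGroup (carrier N)\<^esub> \<psi>)"
      by (rule definable_map_cong) (use * Bij in \<open>simp add: BijGroup_def compose_eq\<close>)
    then show "\<phi> \<otimes>\<^bsub>BijGroup (carrier N)\<^esub> \<psi> \<in> carrier (Aut_def M N)"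
      using m_closed * by (auto simp: mem)
  next
    fix \<phi> assume "\<phi> \<in> carrier (Aut_def M N)"
    then have *: "\<phi> \<in> auto N" "definable_map M UNIV (carrier N) \<phi>" by (auto simp: mem)
    then have "bij_betw \<phi> (carrier N) (carrier N)" using Bij by (simp add: Bij_def)
    then have "definable_map M UNIV (carrier N) (inv_into (carrier N) \<phi>)"
      using definable_map_inv_into[OF *(2)] by (simp add: bij_betw_def)
    then have "definable_map M UNIV (carrier N) (inv\<^bsub>BijGroup (carrier N)\<^esub> \<phi>)"
      by (rule definable_map_cong) (use * Bij in \<open>simp add: inv_BijGroup\<close>)
    then show "inv\<^bsub>BijGroup (carrier N)\<^esub> \<phi> \<in> carrier (Aut_def M N)"
      using m_inv_closed * by (auto simp: mem)
  qed
qed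

lemma act_map_Bij:
  assumes \<sigma>: "\<sigma> \<in> aut_over M A" and X: "definable_set M A n X" and \<phi>: "\<phi> \<in> Bij X"
  shows "act_map X \<sigma> \<phi> \<in> Bij X"
proof -
  note image = aut_image_definable_set[OF \<sigma> X]
  have map: "bij_betw (map \<sigma>) X X"
    using image map_aut_inv(2)[OF \<sigma>] by (metis bij_betw_def inj_on_inverseI)
  have map_inv: "bij_betw (map (inv_into UNIV \<sigma>)) X X"
    by (rule bij_betw_byWitness[where f' = "map \<sigma>"])
      (use map_aut_inv[OF \<sigma>] aut_definable_set[OF \<sigma> X] in \<open>auto simp del: map_map, metis+\<close>)
  have "bij_betw (map \<sigma> \<circ> (\<phi> \<circ> map (inv_into UNIV \<sigma>))) X X"
    using \<phi> by (intro bij_betw_trans[OF bij_betw_trans[OF map_inv] map]) (simp add: Bij_def)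
  then have "bij_betw (act_map X \<sigma> \<phi>) X X"
    by (rule bij_betw_cong[THEN iffD1, rotated]) (simp add: act_map_def image)
  then show ?thesis by (simp add: Bij_def act_map_def image)
qed

text \<open>The value of \<open>\<phi>\<^sup>-\<^sup>1 \<circ> \<psi> \<circ> \<sigma>(\<phi>)\<close> at \<open>\<sigma>(y)\<close>. Evaluating at points of the form \<open>\<sigma>(y)\<close> makes the inner
  \<open>\<sigma>\<^sup>-\<^sup>1\<close> in \<open>\<sigma>(\<phi>) = \<sigma> \<circ> \<phi> \<circ> \<sigma>\<^sup>-\<^sup>1\<close> disappear.\<close>

lemma Aut_def_twist_apply:
  assumes N: "group N" "definable_set M A n (carrier N)" and \<sigma>: "\<sigma> \<in> aut_over M A"
    and \<phi>: "\<phi> \<in> carrier (Aut_def M N)" and \<psi>: "\<psi> \<in> carrier (Aut_def M N)" and y: "y \<in> carrier N"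
  shows "(inv\<^bsub>Aut_def M N\<^esub> \<phi> \<otimes>\<^bsub>Aut_def M N\<^esub> \<psi> \<otimes>\<^bsub>Aut_def M N\<^esub> act_map (carrier N) \<sigma> \<phi>) (map \<sigma> y)
    = inv_into (carrier N) \<phi> (\<psi> (map \<sigma> (\<phi> y)))"
proof -
  have Aut: "Aut_def M N = (BijGroup (carrier N))\<lparr>carrier := carrier (Aut_def M N)\<rparr>"
    by (simp add: Aut_def_def AutoGroup_def)
  have sub: "subgroup (carrier (Aut_def M N)) (BijGroup (carrier N))"
    by (rule Aut_def_subgroup[OF N])
  have Bij: "\<phi> \<in> Bij (carrier N)" "\<psi> \<in> Bij (carrier N)"
    using subgroup.subset[OF sub] \<phi> \<psi> by (auto simp: BijGroup_def)
  have inv: "inv\<^bsub>Aut_def M N\<^esub> \<phi> = restrict (inv_into (carrier N) \<phi>) (carrier N)"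
    using group.m_inv_consistent[OF group_BijGroup sub \<phi>] inv_BijGroup[OF Bij(1)] Aut by simp
  have mult: "f \<otimes>\<^bsub>Aut_def M N\<^esub> g = compose (carrier N) f g"
    if "f \<in> Bij (carrier N)" "g \<in> Bij (carrier N)" for f g
    using that by (simp add: Aut_def_def AutoGroup_def BijGroup_def)
  have act: "act_map (carrier N) \<sigma> \<phi> \<in> Bij (carrier N)"
    by (rule act_map_Bij[OF \<sigma> N(2) Bij(1)])
  have \<sigma>y: "map \<sigma> y \<in> carrier N" using y aut_definable_set[OF \<sigma> N(2)] by simp
  have "\<phi> y \<in> carrier N" using Bij(1) y Bij_imp_funcset by blast
  then have "map \<sigma> (\<phi> y) \<in> carrier N" using aut_definable_set[OF \<sigma> N(2)] by simp
  moreover from this have "\<psi> (map \<sigma> (\<phi> y)) \<in> carrier N" using Bij(2) Bij_imp_funcset by blast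
  moreover have "act_map (carrier N) \<sigma> \<phi> (map \<sigma> y) = map \<sigma> (\<phi> y)"
    unfolding act_map_def using y by (simp add: map_aut_inv(2)[OF \<sigma>] del: map_map)
  ultimately show ?thesis
    using restrict_inv_into_Bij[OF Bij(1)] Bij(2) act \<sigma>y
    by (simp add: inv mult compose_Bij compose_eq)
qed

section \<open>The twisting isomorphisms\<close>

text \<open>Every point of \<open>N\<close> has the form \<open>\<sigma>(f h)\<close>, because \<open>N\<close> is invariant under \<open>\<sigma>\<close>. At that point the map
  \<open>f \<circ> \<sigma>(f\<^sup>-\<^sup>1)\<close> takes the value \<open>f(\<sigma> h)\<close>, and \<open>\<Lambda>\<^sub>\<Phi>(\<sigma>)\<close> the value \<open>\<sigma> * f(h)\<close>.\<close>

lemma twisting_isos_iff: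
  assumes H: "definable_group M A H" and normal: "N \<lhd> G" and N: "definable_set M A n N"
    and f: "f \<in> definable_iso M H (G\<lparr>carrier := N\<rparr>)"
  shows "f \<in> twisting_isos M A G N \<Phi> H \<longleftrightarrow>
    (\<forall>\<sigma>\<in>aut_over M A. \<forall>h\<in>carrier H. f (map \<sigma> h) = twisted_act G \<Phi> \<sigma> (f h))"
proof -
  have bij: "bij_betw f (carrier H) N" using f by (simp add: definable_iso_def iso_def)
  have "compose N f (act_map N \<sigma> (inv_into (carrier H) f)) = conj_cocycle M A G N \<Phi> \<sigma>
    \<longleftrightarrow> (\<forall>h\<in>carrier H. f (map \<sigma> h) = twisted_act G \<Phi> \<sigma> (f h))" if \<sigma>: "\<sigma> \<in> aut_over M A" for \<sigma>
  proof -
    have N_eq: "N = (\<lambda>h. map \<sigma> (f h)) ` carrier H"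
      using aut_image_definable_set[OF \<sigma> N] bij by (auto simp: bij_betw_def image_image)
    have "compose N f (act_map N \<sigma> (inv_into (carrier H) f)) (map \<sigma> (f h)) = f (map \<sigma> h)"
      if "h \<in> carrier H" for h
    proof -
      have "f h \<in> N" using bij that by (rule bij_betw_apply)
      then have "map \<sigma> (f h) \<in> N" "act_map N \<sigma> (inv_into (carrier H) f) (map \<sigma> (f h)) = map \<sigma> h"
        using aut_definable_set[OF \<sigma> N] bij_betw_inv_into_left[OF bij that]
        by (simp_all add: act_map_def map_aut_inv(2)[OF \<sigma>] del: map_map)
      then show ?thesis by (simp add: compose_eq)
    qed
    moreover have "conj_cocycle M A G N \<Phi> \<sigma> (map \<sigma> (f h)) = twisted_act G \<Phi> \<sigma> (f h)"
      if "h \<in> carrier H" for h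
      using \<sigma> N_eq that by (auto simp: conj_cocycle_def twisted_act_def)
    moreover have "compose N f (act_map N \<sigma> (inv_into (carrier H) f)) = conj_cocycle M A G N \<Phi> \<sigma> \<longleftrightarrow>
        (\<forall>x\<in>N. compose N f (act_map N \<sigma> (inv_into (carrier H) f)) x = conj_cocycle M A G N \<Phi> \<sigma> x)"
      using \<sigma> by (auto simp: conj_cocycle_def intro!: extensionalityI[of _ N])
    ultimately show ?thesis by (subst (asm) (5) N_eq) simp
  qed
  then show ?thesis using f by (simp add: twisting_isos_def)
qed

text \<open>Both cocycles are compared with the representative \<open>\<Theta>\<close> by which the class is given: if \<open>b\<close> leads
  from \<open>\<Theta>\<close> to \<open>\<Phi>\<close> and \<open>c\<close> from \<open>\<Theta>\<close> to \<open>\<Psi>\<close>, then \<open>b\<^sup>-\<^sup>1 c\<close> leads from \<open>\<Phi>\<close> to \<open>\<Psi>\<close>.\<close>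

lemma H1_class_cohomologous:
  assumes G: "definable_group M A G" and \<mu>: "\<mu> \<in> H1_def M A map G"
    and \<Phi>: "\<Phi> \<in> \<mu>" and \<Psi>: "\<Psi> \<in> \<mu>"
  shows "\<exists>b\<in>carrier G. \<forall>\<sigma>\<in>aut_over M A. \<Psi> \<sigma> = inv\<^bsub>G\<^esub> b \<otimes>\<^bsub>G\<^esub> \<Phi> \<sigma> \<otimes>\<^bsub>G\<^esub> map \<sigma> b"
proof -
  interpret group G using G by (simp add: definable_group_def)
  from \<mu> obtain \<Theta> where \<Theta>: "\<Theta> \<in> Z1_def M A map G"
    and \<mu>_eq: "\<mu> = cohomologous (aut_over M A) map G (Z1_def M A map G) `` {\<Theta>}"
    unfolding H1_def_def by (rule quotientE)
  from \<Phi> obtain b where b: "b \<in> carrier G"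
    "\<And>\<sigma>. \<sigma> \<in> aut_over M A \<Longrightarrow> \<Phi> \<sigma> = inv\<^bsub>G\<^esub> b \<otimes>\<^bsub>G\<^esub> \<Theta> \<sigma> \<otimes>\<^bsub>G\<^esub> map \<sigma> b"
    unfolding \<mu>_eq cohomologous_def by blast
  from \<Psi> obtain c where c: "c \<in> carrier G"
    "\<And>\<sigma>. \<sigma> \<in> aut_over M A \<Longrightarrow> \<Psi> \<sigma> = inv\<^bsub>G\<^esub> c \<otimes>\<^bsub>G\<^esub> \<Theta> \<sigma> \<otimes>\<^bsub>G\<^esub> map \<sigma> c"
    unfolding \<mu>_eq cohomologous_def by blast
  have "\<Psi> \<sigma> = inv\<^bsub>G\<^esub> (inv\<^bsub>G\<^esub> b \<otimes>\<^bsub>G\<^esub> c) \<otimes>\<^bsub>G\<^esub> \<Phi> \<sigma> \<otimes>\<^bsub>G\<^esub> map \<sigma> (inv\<^bsub>G\<^esub> b \<otimes>\<^bsub>G\<^esub> c)"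
    if \<sigma>: "\<sigma> \<in> aut_over M A" for \<sigma>
  proof -
    interpret \<sigma>: group_hom G G "map \<sigma>"
      by unfold_locales (rule aut_hom_definable_group[OF \<sigma> G])
    have [simp]: "\<Theta> \<sigma> \<in> carrier G" using \<Theta> \<sigma> by (auto simp: Z1_def_def cocycles_def dest: PiE_mem)
    have cancel: "x \<otimes>\<^bsub>G\<^esub> (inv\<^bsub>G\<^esub> x \<otimes>\<^bsub>G\<^esub> y) = y" if "x \<in> carrier G" "y \<in> carrier G" for x y
      using that by (simp flip: m_assoc)
    show ?thesis
      using b(1) c(1) by (simp add: b(2)[OF \<sigma>] c(2)[OF \<sigma>] inv_mult_group m_assoc cancel)
  qed
  then show ?thesis using b(1) c(1) by blast
qed

text \<open>Ensures that classes in \<open>H1_Aut\<close> are nonempty, so that two cocycles with the same class are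
  both cohomologous to a common third one.\<close>

lemma Z1_Aut_class_refl:
  assumes N: "group N" "definable_set M A n (carrier N)" and \<Lambda>: "\<Lambda> \<in> Z1_Aut M A N"
  shows "\<Lambda> \<in> H1_Aut_class M A N \<Lambda>"
proof -
  have Aut: "Aut_def M N = (BijGroup (carrier N))\<lparr>carrier := carrier (Aut_def M N)\<rparr>"
    by (simp add: Aut_def_def AutoGroup_def)
  interpret group "Aut_def M N"
    using subgroup.subgroup_is_group[OF Aut_def_subgroup[OF N] group_BijGroup] Aut by simp
  have one: "\<one>\<^bsub>Aut_def M N\<^esub> = (\<lambda>x\<in>carrier N. x)"
    by (simp add: Aut_def_def AutoGroup_def BijGroup_def)
  have "act_map (carrier N) \<sigma> \<one>\<^bsub>Aut_def M N\<^esub> = \<one>\<^bsub>Aut_def M N\<^esub>" if \<sigma>: "\<sigma> \<in> aut_over M A" for \<sigma>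
    unfolding one act_map_def aut_image_definable_set[OF \<sigma> N(2)]
  proof (rule restrict_ext)
    fix x assume x: "x \<in> carrier N"
    have "map (inv_into UNIV \<sigma>) x \<in> carrier N"
      using x aut_definable_set[OF \<sigma> N(2), of "map (inv_into UNIV \<sigma>) x"] map_aut_inv(1)[OF \<sigma>, of x]
      by (simp del: map_map)
    then show "map \<sigma> ((\<lambda>x\<in>carrier N. x) (map (inv_into UNIV \<sigma>) x)) = x"
      using map_aut_inv(1)[OF \<sigma>, of x] by (simp del: map_map)
  qed
  moreover have "\<Lambda> \<sigma> \<in> carrier (Aut_def M N)" if "\<sigma> \<in> aut_over M A" for \<sigma>
    using \<Lambda> that by (auto simp: Z1_Aut_def cocycles_def dest: PiE_mem)
  ultimately show ?thesis
    using \<Lambda> unfolding H1_Aut_class_def cohomologous_def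
    by (auto intro!: bexI[of _ "\<one>\<^bsub>Aut_def M N\<^esub>"])
qed

text \<open>Let \<open>\<Lambda>\<close> be a common element of the classes of \<open>g\<^sup>-\<^sup>1 \<circ> \<sigma>(g)\<close> and \<open>\<Lambda>\<^bsub>\<Phi>\<^sub>0\<^esub>\<close>, reached by \<open>\<psi>\<close> and \<open>\<phi>\<close>
  respectively. Evaluating \<open>\<Lambda>(\<sigma>)\<close> at \<open>\<sigma>(y)\<close> in the two ways gives
  \<open>(g \<circ> \<psi>)\<^sup>-\<^sup>1(\<sigma>(g(\<psi> y))) = \<phi>\<^sup>-\<^sup>1(\<Phi>\<^sub>0(\<sigma>) \<sigma>(\<phi> y) \<Phi>\<^sub>0(\<sigma>)\<^sup>-\<^sup>1)\<close>, which for \<open>y = (g \<circ> \<psi>)\<^sup>-\<^sup>1(h)\<close> is the equivariance of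
  \<open>u = \<phi> \<circ> (g \<circ> \<psi>)\<^sup>-\<^sup>1\<close>.\<close>

lemma twisting_isos_nonempty:
  assumes G: "definable_group M A G" and normal: "N \<lhd> G" and N: "definable_set M A n N"
    and \<mu>: "\<mu> \<in> H1_def M A map G" and H: "associated_form M A G N \<mu> H" and \<Phi>: "\<Phi> \<in> \<mu>"
  shows "twisting_isos M A G N \<Phi> H \<noteq> {}"
proof -
  interpret normal N G by (rule normal)
  let ?N = "G\<lparr>carrier := N\<rparr>"
  have group_N: "group ?N" by (rule subgroup_is_group) unfold_locales
  have N': "definable_set M A n (carrier ?N)" using N by simp
  from H obtain \<Phi>\<^sub>0 where \<Phi>\<^sub>0: "\<Phi>\<^sub>0 \<in> \<mu>"
    and corr: "form_corresponds M A ?N H (H1_Aut_class M A ?N (conj_cocycle M A G N \<Phi>\<^sub>0))"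
    unfolding associated_form_def by blast
  have H_grp: "definable_group M A H"
    using corr unfolding form_corresponds_def A_form_def by blast
  from corr obtain g where g: "g \<in> definable_iso M ?N H"
    and same: "H1_Aut_class M A ?N (form_cocycle M A ?N g) = H1_Aut_class M A ?N (conj_cocycle M A G N \<Phi>\<^sub>0)"
    unfolding form_corresponds_def by blast
  from corr have "H1_Aut_class M A ?N (conj_cocycle M A G N \<Phi>\<^sub>0) \<in> H1_Aut M A ?N"
    unfolding form_corresponds_def by blast
  then obtain \<Lambda> where \<Lambda>: "\<Lambda> \<in> H1_Aut_class M A ?N (conj_cocycle M A G N \<Phi>\<^sub>0)"
    unfolding H1_Aut_def using Z1_Aut_class_refl[OF group_N N']
    by (auto simp: H1_Aut_class_def elim!: quotientE)
  from \<Lambda> obtain \<phi> where conj_Z1: "conj_cocycle M A G N \<Phi>\<^sub>0 \<in> Z1_Aut M A ?N"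
    and \<phi>: "\<phi> \<in> carrier (Aut_def M ?N)"
    and \<Lambda>_conj: "\<And>\<sigma>. \<sigma> \<in> aut_over M A \<Longrightarrow> \<Lambda> \<sigma> = inv\<^bsub>Aut_def M ?N\<^esub> \<phi> \<otimes>\<^bsub>Aut_def M ?N\<^esub>
      conj_cocycle M A G N \<Phi>\<^sub>0 \<sigma> \<otimes>\<^bsub>Aut_def M ?N\<^esub> act_map (carrier ?N) \<sigma> \<phi>"
    unfolding H1_Aut_class_def cohomologous_def by blast
  from \<Lambda>[folded same] obtain \<psi> where form_Z1: "form_cocycle M A ?N g \<in> Z1_Aut M A ?N"
    and \<psi>: "\<psi> \<in> carrier (Aut_def M ?N)"
    and \<Lambda>_form: "\<And>\<sigma>. \<sigma> \<in> aut_over M A \<Longrightarrow> \<Lambda> \<sigma> = inv\<^bsub>Aut_def M ?N\<^esub> \<psi> \<otimes>\<^bsub>Aut_def M ?N\<^esub>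
      form_cocycle M A ?N g \<sigma> \<otimes>\<^bsub>Aut_def M ?N\<^esub> act_map (carrier ?N) \<sigma> \<psi>"
    unfolding H1_Aut_class_def cohomologous_def by blast
  have Aut_iso: "\<chi> \<in> definable_iso M ?N ?N" if "\<chi> \<in> carrier (Aut_def M ?N)" for \<chi>
    using that by (auto simp: Aut_def_def definable_iso_def auto_def iso_def Bij_def)
  have \<phi>_bij: "bij_betw \<phi> N N" and \<psi>_bij: "bij_betw \<psi> N N" and g_bij: "bij_betw g N (carrier H)"
    using Aut_iso[OF \<phi>] Aut_iso[OF \<psi>] g by (simp_all add: definable_iso_def iso_def)
  define u where "u h = \<phi> (inv_into N \<psi> (inv_into N g h))" for h
  have u: "u \<in> definable_iso M H ?N"
    unfolding u_def
    using definable_iso_comp[OF definable_iso_comp[OF definable_iso_inv[OF group_N g]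
          definable_iso_inv[OF group_N Aut_iso[OF \<psi>]]] Aut_iso[OF \<phi>]] by simp
  have u_equivariant: "u (map \<sigma> h) = twisted_act G \<Phi>\<^sub>0 \<sigma> (u h)"
    if \<sigma>: "\<sigma> \<in> aut_over M A" and h: "h \<in> carrier H" for \<sigma> h
  proof -
    have cocycle_mem: "\<Lambda>' \<sigma> \<in> carrier (Aut_def M ?N)" if "\<Lambda>' \<in> Z1_Aut M A ?N" for \<Lambda>'
      using that \<sigma> by (auto simp: Z1_Aut_def cocycles_def dest: PiE_mem)
    have \<sigma>_N: "map \<sigma> x \<in> N" if "x \<in> N" for x using that aut_definable_set[OF \<sigma> N] by simp
    define y where "y = inv_into N \<psi> (inv_into N g h)"
    have gh: "inv_into N g h \<in> N" using bij_betw_apply[OF bij_betw_inv_into[OF g_bij] h] .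
    have y: "y \<in> N" unfolding y_def using bij_betw_apply[OF bij_betw_inv_into[OF \<psi>_bij] gh] .
    have \<psi>y: "\<psi> y \<in> N" "g (\<psi> y) = h"
      unfolding y_def using bij_betw_inv_into_right[OF \<psi>_bij gh] bij_betw_inv_into_right[OF g_bij h] gh
      by simp_all
    have uh: "u h = \<phi> y" "\<phi> y \<in> N" using bij_betw_apply[OF \<phi>_bij y] by (simp_all add: u_def y_def)
    have form: "form_cocycle M A ?N g \<sigma> (map \<sigma> (\<psi> y)) = inv_into N g (map \<sigma> h)"
      using \<sigma> \<sigma>_N[OF \<psi>y(1)] \<psi>y
      by (simp add: form_cocycle_def compose_eq act_map_def map_aut_inv(2)[OF \<sigma>] del: map_map)
    have conj: "conj_cocycle M A G N \<Phi>\<^sub>0 \<sigma> (map \<sigma> (\<phi> y)) = twisted_act G \<Phi>\<^sub>0 \<sigma> (u h)"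
      using \<sigma> \<sigma>_N[OF uh(2)] uh(1) by (simp add: conj_cocycle_def twisted_act_def)
    have "conj_cocycle M A G N \<Phi>\<^sub>0 \<sigma> \<in> Bij N"
      using cocycle_mem[OF conj_Z1] by (simp add: Aut_def_def auto_def)
    then have tw_N: "twisted_act G \<Phi>\<^sub>0 \<sigma> (u h) \<in> N"
      using Bij_imp_funcset \<sigma>_N[OF uh(2)] unfolding conj[symmetric] by blast
    have "\<Lambda> \<sigma> (map \<sigma> y) = inv_into N \<psi> (inv_into N g (map \<sigma> h))"
      unfolding \<Lambda>_form[OF \<sigma>]
      using Aut_def_twist_apply[OF group_N N' \<sigma> \<psi> cocycle_mem[OF form_Z1], of y] y by (simp add: form)
    moreover have "\<Lambda> \<sigma> (map \<sigma> y) = inv_into N \<phi> (twisted_act G \<Phi>\<^sub>0 \<sigma> (u h))"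
      unfolding \<Lambda>_conj[OF \<sigma>]
      using Aut_def_twist_apply[OF group_N N' \<sigma> \<phi> cocycle_mem[OF conj_Z1], of y] y by (simp add: conj)
    ultimately show ?thesis
      using bij_betw_inv_into_right[OF \<phi>_bij tw_N] by (simp add: u_def)
  qed
  obtain b where b: "b \<in> carrier G"
    and \<Phi>_eq: "\<And>\<sigma>. \<sigma> \<in> aut_over M A \<Longrightarrow> \<Phi> \<sigma> = inv\<^bsub>G\<^esub> b \<otimes>\<^bsub>G\<^esub> \<Phi>\<^sub>0 \<sigma> \<otimes>\<^bsub>G\<^esub> map \<sigma> b"
    using H1_class_cohomologous[OF G \<mu> \<Phi>\<^sub>0 \<Phi>] by blast
  \<comment> \<open>conjugation by \<open>b\<^sup>-\<^sup>1\<close> absorbs the factors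
    \<open>b\<^sup>-\<^sup>1\<close> and \<open>\<sigma>(b)\<close> by which
    \<open>\<Phi>\<close> differs from \<open>\<Phi>\<^sub>0\<close>\<close>
  define f where "f h = inv\<^bsub>G\<^esub> b \<otimes>\<^bsub>G\<^esub> u h \<otimes>\<^bsub>G\<^esub> inv\<^bsub>G\<^esub> (inv\<^bsub>G\<^esub> b)" for h
  have f: "f \<in> definable_iso M H ?N"
    unfolding f_def using definable_iso_comp[OF u conj_definable_iso[OF G normal N inv_closed[OF b]]] .
  have "f (map \<sigma> h) = twisted_act G \<Phi> \<sigma> (f h)"
    if \<sigma>: "\<sigma> \<in> aut_over M A" and h: "h \<in> carrier H" for \<sigma> h
  proof -
    interpret \<sigma>: group_hom G G "map \<sigma>"
      by unfold_locales (rule aut_hom_definable_group[OF \<sigma> G])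
    have "u h \<in> N" using u h by (auto simp: definable_iso_def iso_def dest: bij_betw_apply)
    then have [simp]: "u h \<in> carrier G" using subset by blast
    have [simp]: "\<Phi>\<^sub>0 \<sigma> \<in> carrier G"
      using \<mu> \<Phi>\<^sub>0 \<sigma> unfolding H1_def_def quotient_def cohomologous_def Z1_def_def cocycles_def
      by (auto dest: PiE_mem)
    have cancel: "x \<otimes>\<^bsub>G\<^esub> (inv\<^bsub>G\<^esub> x \<otimes>\<^bsub>G\<^esub> y) = y" if "x \<in> carrier G" "y \<in> carrier G" for x y
      using that by (simp flip: m_assoc)
    show ?thesis
      using b by (simp add: f_def u_equivariant[OF \<sigma> h] twisted_act_def \<Phi>_eq[OF \<sigma>]
          inv_mult_group m_assoc cancel)
  qed
  then show ?thesis using twisting_isos_iff[OF H_grp normal N f] by blast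
qed

theorem theorem4p2:
  fixes M :: "('f, 'r, 'a) fo_structure" and A :: "'a set"
    and G H :: "'a list monoid" and N :: "'a list set"
    and \<mu> :: "(('a \<Rightarrow> 'a) \<Rightarrow> 'a list) set" and \<Phi> :: "('a \<Rightarrow> 'a) \<Rightarrow> 'a list"
  assumes "atomic_over M A"
    and "homogeneous_over M A"
    and "eliminates_imaginaries M"
    and "definable_group M A G"
    and "N \<lhd> G"
    and "\<exists>n. definable_set M A n N"
    and "\<mu> \<in> H1_def M A map G"
    and "associated_form M A G N \<mu> H"
    and "\<Phi> \<in> \<mu>"
  shows "twisting_isos M A G N \<Phi> H \<noteq> {} \<and>
    (\<forall>f\<in>twisting_isos M A G N \<Phi> H.
       \<exists>F. bij_betw F (H1_def M A map H)
                      (H1_def M A (twisted_act G \<Phi>) (G\<lparr>carrier := N\<rparr>))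
         \<and> F (H1_base M A map H) = H1_base M A (twisted_act G \<Phi>) (G\<lparr>carrier := N\<rparr>)
         \<and> (\<forall>\<Psi>\<in>Z1_def M A map H.
              compose (aut_over M A) f \<Psi> \<in> Z1_def M A (twisted_act G \<Phi>) (G\<lparr>carrier := N\<rparr>)
              \<and> F (H1_class M A map H \<Psi>)
                = H1_class M A (twisted_act G \<Phi>) (G\<lparr>carrier := N\<rparr>)
                    (compose (aut_over M A) f \<Psi>)))"
proof -
  obtain n where N: "definable_set M A n N"
    using assms(6) by blast
  have H: "definable_group M A H"
    using assms(8) unfolding associated_form_def form_corresponds_def A_form_def by blast
  have group_N: "group (G\<lparr>carrier := N\<rparr>)"
    using assms(4,5) by (intro subgroup.subgroup_is_group normal_imp_subgroup)
      (auto simp: definable_group_def)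
  have "\<exists>F. bij_betw F (H1_def M A map H) (H1_def M A (twisted_act G \<Phi>) (G\<lparr>carrier := N\<rparr>))
         \<and> F (H1_base M A map H) = H1_base M A (twisted_act G \<Phi>) (G\<lparr>carrier := N\<rparr>)
         \<and> (\<forall>\<Psi>\<in>Z1_def M A map H.
              compose (aut_over M A) f \<Psi> \<in> Z1_def M A (twisted_act G \<Phi>) (G\<lparr>carrier := N\<rparr>)
              \<and> F (H1_class M A map H \<Psi>)
                = H1_class M A (twisted_act G \<Phi>) (G\<lparr>carrier := N\<rparr>)
                    (compose (aut_over M A) f \<Psi>))"
    if f: "f \<in> twisting_isos M A G N \<Phi> H" for f
  proof -
    have f_iso: "f \<in> definable_iso M H (G\<lparr>carrier := N\<rparr>)"
      using f by (simp add: twisting_isos_def)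
    interpret equivariant_definable_iso H "G\<lparr>carrier := N\<rparr>" M A map "twisted_act G \<Phi>" f
    proof (intro equivariant_definable_iso.intro equivariant_definable_iso_axioms.intro)
      show "group H" using H by (simp add: definable_group_def)
      show "map \<sigma> x \<in> carrier H" if "\<sigma> \<in> aut_over M A" "x \<in> carrier H" for \<sigma> x
        using hom_in_carrier[OF aut_hom_definable_group[OF that(1) H] that(2)] .
      show "f (map \<sigma> x) = twisted_act G \<Phi> \<sigma> (f x)" if "\<sigma> \<in> aut_over M A" "x \<in> carrier H" for \<sigma> x
        using f that twisting_isos_iff[OF H assms(5) N f_iso] by blast
    qed (rule group_N f_iso)+
    have "push \<Psi> \<in> Z1_def M A (twisted_act G \<Phi>) (G\<lparr>carrier := N\<rparr>)
        \<and> push ` H1_class M A map H \<Psi> = H1_class M A (twisted_act G \<Phi>) (G\<lparr>carrier := N\<rparr>) (push \<Psi>)"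
      if "\<Psi> \<in> Z1_def M A map H" for \<Psi>
      using that push_Z1_iff push_class Z1_subset by blast
    then show ?thesis
      using push_H1_bij push_base by (intro exI[of _ "(`) push"]) blast
  qed
  then show ?thesis
    using twisting_isos_nonempty[OF assms(4,5) N assms(7-9)] by blast
qed

end
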